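(* For each $d\ge1$ there is a constant $C_d>0$ and an online algorithm such that the following holds for all $t\ge1$ and $\delta\in(0,1)$. Let $\mathfrak{p}$ be a known probability distribution on $[0,1]^d$ and let $x_1,\dots,x_t$ be drawn from $\mathfrak{p}$ and revealed one at a time; upon seeing $x_i$ the algorithm chooses $\varepsilon_i\in\{-1,1\}$. Then with probability at least $1-\delta$, for all axis-parallel boxes $B\subseteq[0,1]^d$ and all $i\in[t]$, \[\mathrm{disc}_i(B):=\Big|\sum_{j=1}^i\varepsilon_j1_B(x_j)\Big|\le C_d\log^{d+1}(dt/\delta).\]
   Context: $1_B$ is the indicator function of $B$. The points $x_1,\dots,x_t$ are drawn from $\mathfrak{p}$ (independently), and the algorithm's choice of $\varepsilon_i$ may depend on $\mathfrak{p}$, $x_1,\dots,x_i$ and its own randomness.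
   Formalization: The logarithm is read as ln(max(2, dt/δ)); this differs from log(dt/δ) only for d = t = 1 and δ > 1/2, where the stated bound fails: the box [0,1] has discrepancy 1 after one point while log(1/δ) tends to 0 as δ tends to 1. *)

theory Defs
  imports "HOL-Probability.Probability"
begin

definition distribution_on_cube :: "(real ^ 'd::finite) measure \<Rightarrow> bool" where
  "distribution_on_cube p \<longleftrightarrow>
     prob_space p \<and> sets p = sets borel \<and> measure p (cbox 0 1) = 1"

text \<open>Products of arbitrary real intervals: each side may be open, closed, half-open,
  degenerate or empty.\<close>

definition axis_parallel_box :: "(real ^ 'd::finite) set \<Rightarrow> bool" where
  "axis_parallel_box B \<longleftrightarrow>
     (\<exists>I. (\<forall>k. is_interval (I k :: real set)) \<and> B = {x. \<forall>k. x $ k \<in> I k})"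

text \<open>The private randomness of the algorithm is a sequence of independent uniform
  variables on \<open>[0,1]\<close>; it is made independent of the points by taking a product measure.\<close>

definition seed_space :: "(nat \<Rightarrow> real) measure" where
  "seed_space = (\<Pi>\<^sub>M n\<in>UNIV. uniform_measure lborel {0..1})"

definition run_space :: "'a measure \<Rightarrow> nat \<Rightarrow> ((nat \<Rightarrow> 'a) \<times> (nat \<Rightarrow> real)) measure" where
  "run_space p t = (\<Pi>\<^sub>M i\<in>{1..t}. p) \<Otimes>\<^sub>M seed_space"

text \<open>An algorithm maps the known distribution \<open>p\<close>, its randomness \<open>r\<close> and the list
  \<open>[x\<^sub>1, \<dots>, x\<^sub>i]\<close> of the points revealed so far to the sign \<open>\<epsilon>\<^sub>i\<close>. It is online because
  it sees neither the later points nor the number of points still to come.\<close>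

type_synonym 'd online_alg =
  "(real ^ 'd) measure \<Rightarrow> (nat \<Rightarrow> real) \<Rightarrow> (real ^ 'd) list \<Rightarrow> real"

definition chosen_sign ::
  "'d::finite online_alg \<Rightarrow> (real ^ 'd) measure \<Rightarrow> (nat \<Rightarrow> real) \<Rightarrow> (nat \<Rightarrow> real ^ 'd) \<Rightarrow> nat \<Rightarrow> real"
where
  "chosen_sign A p r x i = A p r (map x [1..<Suc i])"

definition online_algorithm :: "'d::finite online_alg \<Rightarrow> bool" where
  "online_algorithm A \<longleftrightarrow>
     (\<forall>p r xs. A p r xs \<in> {-1, 1}) \<and>
     (\<forall>p. distribution_on_cube p \<longrightarrow>
        (\<forall>i\<ge>1. (\<lambda>(x, r). chosen_sign A p r x i) \<in> borel_measurable (run_space p i)))"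

definition disc :: "(nat \<Rightarrow> real) \<Rightarrow> (nat \<Rightarrow> 'a) \<Rightarrow> nat \<Rightarrow> 'a set \<Rightarrow> real" where
  "disc \<epsilon> x i B = \<bar>\<Sum>j=1..i. \<epsilon> j * indicator B (x j)\<bar>"

text \<open>The bound is \<open>C\<^sub>d log\<^bsup>d+1\<^esup>(dt/\<delta>)\<close>. Since \<open>dt/\<delta> > 2\<close> whenever \<open>dt \<ge> 2\<close>, the truncation
  at 2 has an effect only for \<open>d = t = 1\<close> and \<open>\<delta> > 1/2\<close>. There it is needed: \<open>log(1/\<delta>)\<close> tends
  to 0 as \<open>\<delta>\<close> tends to 1, while the box \<open>[0,1]\<close> always has discrepancy 1 after one point.\<close>

definition trunc_ln :: "real \<Rightarrow> real" where
  "trunc_ln y = ln (max 2 y)"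

end

theory Submission
  imports Defs
begin

text \<open>Every coordinate is cut into \<open>O(2\<^sup>\<kappa>)\<close> cells along the quantiles of its marginal, and a point is
  sent to the 0/1 vector \<open>v\<close> of the \<open>(\<kappa> + 2)\<^sup>d\<close> dyadic boxes of cells that contain it. The
  self-balancing walk of Alweiss, Liu and Sawhney chooses \<open>\<epsilon> = 1\<close> with probability
  \<open>1/2 - \<langle>w, v\<rangle> / (2c)\<close>, which keeps \<open>w = \<Sum> \<epsilon>\<^sub>j v\<^sub>j\<close> sub-Gaussian with variance proxy \<open>c\<close> in every
  direction. A box of cells is a signed combination \<open>u\<close> of dyadic boxes with
  \<open>|u|\<^sup>2 \<le> (4 (\<kappa> + 2))\<^sup>d\<close>, so \<open>\<langle>w, u\<rangle>\<close> is of order \<open>\<kappa>\<^bsup>d+1\<^esup>\<close> except with probability exponentially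
  small in \<open>\<kappa>\<close>; as long as no two points share a cell without sharing the coordinate, every box
  cuts out of the points the same set as some box of cells.

  The horizon and the confidence are unknown to the algorithm, so it runs the walk with
  \<open>\<kappa> = 1, 2, 4, 8, \<dots>\<close> and restarts with the next value as soon as some box exceeds the discrepancy
  guaranteed for the current one. The guarantees grow geometrically, so only the last
  one matters, and a union bound over the deterministic starting times \<open>s < t\<close> replaces an analysis
  of the random restart times.\<close>

subsection \<open>Independent uniform seeds\<close>

text \<open>Overwriting one coordinate by an independent copy preserves a product measure. Keeping
  the old coordinate inside \<open>x\<close> avoids splitting the index set. Later \<open>n\<close>
  is either the current seed or one of the points.\<close>

lemma nn_integral_PiM_resample:
  assumes M: "\<And>i. i \<in> I \<Longrightarrow> prob_space (M i)" and n: "n \<in> I"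
    and f[measurable]: "f \<in> borel_measurable (PiM I M)"
  shows "(\<integral>\<^sup>+x. f x \<partial>PiM I M) = (\<integral>\<^sup>+x. (\<integral>\<^sup>+y. f (x(n := y)) \<partial>M n) \<partial>PiM I M)"
proof -
  interpret N: prob_space "M n" using M n by auto
  interpret P: prob_space "PiM I M" using M by (rule prob_space_PiM)
  interpret pair_sigma_finite "M n" "PiM I M" ..
  have ins: "insert n I = I" using n by auto
  have meas[measurable]: "(\<lambda>(y, x). x(n := y)) \<in> M n \<Otimes>\<^sub>M PiM I M \<rightarrow>\<^sub>M PiM I M"
    unfolding split_beta by (rule measurable_fun_upd[where J = I]) (use n in auto)
  have "(\<integral>\<^sup>+x. f x \<partial>PiM I M) = (\<integral>\<^sup>+x. f x \<partial>distr (M n \<Otimes>\<^sub>M PiM I M) (PiM I M) (\<lambda>(y, x). x(n := y)))"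
    using distr_pair_PiM_eq_PiM[of I M n] M n by (simp add: ins)
  also have "\<dots> = (\<integral>\<^sup>+z. f ((snd z)(n := fst z)) \<partial>(M n \<Otimes>\<^sub>M PiM I M))"
    by (subst nn_integral_distr) (auto simp: split_beta)
  also have "\<dots> = (\<integral>\<^sup>+x. (\<integral>\<^sup>+y. f (x(n := y)) \<partial>M n) \<partial>PiM I M)"
    by (subst nn_integral_snd[symmetric]) (use measurable_compose[OF meas f] in \<open>auto simp: split_beta\<close>)
  finally show ?thesis .
qed

text \<open>Hoeffding's lemma for a sign with mean 2q - 1. \<open>Hoeffdings_lemma_aux\<close> at 2s
  gives the case s \<ge> 0, and exchanging the two outcomes gives the rest.\<close>

lemma two_point_mgf:
  fixes q s :: real
  assumes "0 \<le> q" "q \<le> 1"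
  shows "q * exp s + (1 - q) * exp (- s) \<le> exp ((2 * q - 1) * s + s\<^sup>2 / 2)"
proof -
  have *: "q * exp s + (1 - q) * exp (- s) \<le> exp ((2 * q - 1) * s + s\<^sup>2 / 2)"
    if "0 \<le> q" "q \<le> 1" "0 \<le> s" for q s :: real
  proof -
    have "q * exp s + (1 - q) * exp (- s) = exp (- s) * (1 + q * (exp (2 * s) - 1))"
      by (simp add: algebra_simps flip: exp_add)
    moreover have pos: "1 + q * (exp (2 * s) - 1) > 0"
      using that by (intro add_pos_nonneg) auto
    moreover have "ln (1 + q * (exp (2 * s) - 1)) \<le> 2 * s * q + s\<^sup>2 / 2"
      using Hoeffdings_lemma_aux[of "2 * s" q] that by (simp add: power2_eq_square)
    ultimately have "q * exp s + (1 - q) * exp (- s) \<le> exp (- s) * exp (2 * s * q + s\<^sup>2 / 2)"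
      by (metis exp_le_cancel_iff exp_ln mult_left_mono exp_ge_zero)
    also have "\<dots> = exp ((2 * q - 1) * s + s\<^sup>2 / 2)"
      by (simp add: algebra_simps flip: exp_add)
    finally show ?thesis .
  qed
  show ?thesis
  proof (cases "0 \<le> s")
    case True
    then show ?thesis using * assms by blast
  next
    case False
    then show ?thesis using *[of "1 - q" "- s"] assms by (simp add: algebra_simps)
  qed
qed

abbreviation unif :: "real measure" where
  "unif \<equiv> uniform_measure lborel {0..1}"

lemma prob_space_unif: "prob_space unif"
  by (rule prob_space_uniform_measure) auto

lemma prob_space_seed: "prob_space seed_space"
  unfolding seed_space_def by (rule prob_space_PiM) (rule prob_space_unif)

lemma seed_component_measurable[measurable]: "(\<lambda>r. r i) \<in> borel_measurable seed_space"
proof -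
  have "(\<lambda>r. r i) \<in> seed_space \<rightarrow>\<^sub>M unif"
    unfolding seed_space_def by (rule measurable_component_singleton) simp
  moreover have "sets unif = sets borel" by simp
  ultimately show ?thesis using measurable_cong_sets by blast
qed

lemma space_seed[simp]: "space seed_space = UNIV"
  by (simp add: seed_space_def space_PiM)

lemma sets_seed_Collect: "Measurable.pred seed_space P \<Longrightarrow> {r. P r} \<in> sets seed_space"
  by (drule predE) simp

lemma emeasure_unif_atMost:
  assumes "0 \<le> q" "q \<le> 1"
  shows "emeasure unif {..q} = ennreal q"
proof -
  have "{0..1} \<inter> {..q} = {0..q}" using assms by auto
  then show ?thesis using assms by (simp add: divide_ennreal_def)
qed

lemma nn_integral_unif_threshold:
  assumes q: "0 \<le> q" "q \<le> 1" and ab: "0 \<le> a" "0 \<le> b"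
  shows "(\<integral>\<^sup>+y. ennreal (if y \<le> q then a else b) \<partial>unif) = ennreal (q * a + (1 - q) * b)"
proof -
  interpret prob_space unif by (rule prob_space_unif)
  have "(\<integral>\<^sup>+y. ennreal (if y \<le> q then a else b) \<partial>unif)
      = (\<integral>\<^sup>+y. ennreal a * indicator {..q} y + ennreal b * indicator {q<..} y \<partial>unif)"
    by (rule nn_integral_cong) (auto simp: indicator_def)
  also have "\<dots> = ennreal a * emeasure unif {..q} + ennreal b * emeasure unif {q<..}"
    by (subst nn_integral_add)
       (auto simp: nn_integral_cmult_indicator intro!: borel_measurable_times_ennreal borel_measurable_indicator)
  also have "{q<..} = space unif - {..q}" by auto
  also have "emeasure unif (space unif - {..q}) = ennreal (1 - q)"
    using q prob_compl[of "{..q}"] emeasure_unif_atMost[OF q]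
    by (simp add: emeasure_eq_measure)
  finally show ?thesis
    unfolding emeasure_unif_atMost[OF q]
    using q ab by (simp add: mult.commute flip: ennreal_mult ennreal_plus)
qed

subsection \<open>The self-balancing walk\<close>

text \<open>The vectors enter only through their Gram matrix \<open>G\<close>: the sum is the inner
  product of the current position with the new vector. The walk leaves the origin after time
  \<open>s\<close>, and step \<open>i\<close> uses seed \<open>i\<close> whatever \<open>s\<close>
  is.\<close>

function walk :: "(nat \<Rightarrow> nat \<Rightarrow> real) \<Rightarrow> real \<Rightarrow> (nat \<Rightarrow> real) \<Rightarrow> nat \<Rightarrow> nat \<Rightarrow> real" where
  "walk G c r s i =
     (if r i \<le> 1 / 2 - (\<Sum>j\<in>{s<..<i}. walk G c r s j * G j i) / (2 * c) then 1 else - 1)"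
  by auto
termination by (relation "Wellfounded.measure (\<lambda>(G, c, r, s, i). i)") auto

declare walk.simps[simp del]

definition drift :: "(nat \<Rightarrow> nat \<Rightarrow> real) \<Rightarrow> real \<Rightarrow> (nat \<Rightarrow> real) \<Rightarrow> nat \<Rightarrow> nat \<Rightarrow> real" where
  "drift G c r s i = (\<Sum>j\<in>{s<..<i}. walk G c r s j * G j i)"

text \<open>While this holds, the threshold in \<open>walk\<close> lies in [0,1], so each step has
  conditional mean exactly -\<open>drift\<close> / \<open>c\<close>. The walk goes on when it fails;
  the predicate only marks the event on which the estimates are made.\<close>

definition alive :: "(nat \<Rightarrow> nat \<Rightarrow> real) \<Rightarrow> real \<Rightarrow> (nat \<Rightarrow> real) \<Rightarrow> nat \<Rightarrow> nat \<Rightarrow> bool" where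
  "alive G c r s n \<longleftrightarrow> (\<forall>i\<in>{s<..n}. \<bar>drift G c r s i\<bar> \<le> c)"

lemma walk_eq: "walk G c r s i = (if r i \<le> 1 / 2 - drift G c r s i / (2 * c) then 1 else - 1)"
  by (subst walk.simps) (simp add: drift_def)

lemma walk_cases: "walk G c r s i \<in> {-1, 1}"
  by (simp add: walk_eq)

lemma walk_cong:
  assumes "\<And>j. s < j \<Longrightarrow> j \<le> i \<Longrightarrow> r j = r' j"
    and "\<And>j l. s < j \<Longrightarrow> j < l \<Longrightarrow> l \<le> i \<Longrightarrow> G j l = G' j l" and "s < i"
  shows "walk G c r s i = walk G' c r' s i"
  using assms
proof (induction i rule: less_induct)
  case (less i)
  have "drift G c r s i = drift G' c r' s i"
    unfolding drift_def
    using less by (intro sum.cong refl arg_cong2[where f = "(*)"] less.IH) auto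
  then show ?case using less.prems by (simp add: walk_eq)
qed

lemma walk_upd: "i < n \<Longrightarrow> walk G c (r(n := y)) s i = walk G c r s i"
proof (induction i rule: less_induct)
  case (less i)
  have "drift G c (r(n := y)) s i = drift G c r s i"
    unfolding drift_def
    using less by (intro sum.cong refl arg_cong2[where f = "(*)"] less.IH) auto
  then show ?case using less.prems by (simp add: walk_eq del: fun_upd_apply) simp
qed

text \<open>The drift at time \<open>n\<close> involves earlier signs only, so it is fixed before
  seed \<open>n\<close> is drawn. Hence the bound is not strict, here and in
  \<open>alive_upd\<close>.\<close>

lemma drift_upd: "i \<le> n \<Longrightarrow> drift G c (r(n := y)) s i = drift G c r s i"
  unfolding drift_def by (intro sum.cong) (auto simp: walk_upd)

lemma alive_upd: "m \<le> n \<Longrightarrow> alive G c (r(n := y)) s m \<longleftrightarrow> alive G c r s m"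
  unfolding alive_def by (intro ball_cong) (auto simp: drift_upd)

lemma walk_measurable:
  assumes "\<And>j l. s < j \<Longrightarrow> j < l \<Longrightarrow> l \<le> i \<Longrightarrow> (\<lambda>\<omega>. G \<omega> j l) \<in> borel_measurable M"
    and "\<And>j. s < j \<Longrightarrow> j \<le> i \<Longrightarrow> (\<lambda>\<omega>. r \<omega> j) \<in> borel_measurable M" and "s < i"
  shows "(\<lambda>\<omega>. walk (G \<omega>) c (r \<omega>) s i) \<in> borel_measurable M"
  using assms
proof (induction i rule: less_induct)
  case (less i)
  have [measurable]: "(\<lambda>\<omega>. drift (G \<omega>) c (r \<omega>) s i) \<in> borel_measurable M"
    unfolding drift_def using less by (intro borel_measurable_sum borel_measurable_times less.IH) auto
  have [measurable]: "(\<lambda>\<omega>. r \<omega> i) \<in> borel_measurable M" using less by auto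
  show ?case unfolding walk_eq by measurable
qed

lemma walk_seed_measurable[measurable]:
  "(\<lambda>r. walk G c r s i) \<in> borel_measurable seed_space"
proof (cases "s < i")
  case True
  then show ?thesis by (intro walk_measurable[where G = "\<lambda>_. G"]) auto
next
  case False
  then have "drift G c r s i = 0" for r by (auto simp: drift_def)
  then show ?thesis unfolding walk_eq by simp
qed

lemma drift_seed_measurable[measurable]: "(\<lambda>r. drift G c r s i) \<in> borel_measurable seed_space"
  unfolding drift_def by measurable

lemma alive_seed_measurable[measurable]: "Measurable.pred seed_space (\<lambda>r. alive G c r s n)"
  unfolding alive_def by measurable

definition gram :: "'b set \<Rightarrow> (nat \<Rightarrow> 'b \<Rightarrow> real) \<Rightarrow> nat \<Rightarrow> nat \<Rightarrow> real" where
  "gram I v j i = (\<Sum>b\<in>I. v j b * v i b)"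

text \<open>Conditionally on the past, step \<open>i\<close> has mean \<open>- \<langle>w, v\<^sub>i\<rangle> / c\<close>, so it replaces \<open>\<theta>\<close> by
  \<open>\<theta> - (\<langle>v\<^sub>i, \<theta>\<rangle> / c) v\<^sub>i\<close>; the decrease of \<open>c |\<theta>|\<^sup>2\<close> pays for the variance \<open>\<langle>v\<^sub>i, \<theta>\<rangle>\<^sup>2\<close> of the step.\<close>

lemma walk_mgf:
  fixes v :: "nat \<Rightarrow> 'b \<Rightarrow> real"
  assumes vc: "\<And>i. (\<Sum>b\<in>I. (v i b)\<^sup>2) \<le> c" and c: "c > 0"
  shows "(\<integral>\<^sup>+r. ennreal (exp (\<Sum>j\<in>{s<..n}. walk (gram I v) c r s j * (\<Sum>b\<in>I. v j b * \<theta> b)))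
            * indicator {r. alive (gram I v) c r s n} r \<partial>seed_space)
          \<le> ennreal (exp (c * (\<Sum>b\<in>I. (\<theta> b)\<^sup>2) / 2))"
proof (induction n arbitrary: \<theta>)
  interpret prob_space seed_space by (rule prob_space_seed)
  have triv: "(\<integral>\<^sup>+r. ennreal (exp 0) * indicator X r \<partial>seed_space)
      \<le> ennreal (exp (c * (\<Sum>b\<in>I. (\<theta> b)\<^sup>2) / 2))" for X \<theta>
  proof -
    have "(\<integral>\<^sup>+r. ennreal (exp 0) * indicator X r \<partial>seed_space) \<le> (\<integral>\<^sup>+r. 1 \<partial>seed_space)"
      by (intro nn_integral_mono) (auto simp: indicator_def)
    also have "\<dots> = 1" using emeasure_space_1 by simp
    also have "1 \<le> ennreal (exp (c * (\<Sum>b\<in>I. (\<theta> b)\<^sup>2) / 2))"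
      using c by (auto intro!: mult_nonneg_nonneg sum_nonneg)
    finally show ?thesis .
  qed
  {
    case 0
    show ?case using triv by simp
  next
    case (Suc n)
    define m where "m = Suc n"
    show ?case
    proof (cases "s < m")
      case False
      then have "{s<..Suc n} = {}" by (auto simp: m_def)
      then show ?thesis using triv by simp
    next
      case True
      then have split: "{s<..Suc n} = insert m {s<..n}" and notin: "m \<notin> {s<..n}" and lt: "{s<..<m} = {s<..n}"
        by (auto simp: m_def)
      define a where "a = (\<Sum>b\<in>I. v m b * \<theta> b)"
      define \<theta>' where "\<theta>' = (\<lambda>b. \<theta> b - a / c * v m b)"
      define S where "S r = (\<Sum>j\<in>{s<..n}. walk (gram I v) c r s j * (\<Sum>b\<in>I. v j b * \<theta> b))" for r
      define S' where "S' r = (\<Sum>j\<in>{s<..n}. walk (gram I v) c r s j * (\<Sum>b\<in>I. v j b * \<theta>' b))" for r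
      have S_upd: "S (r(m := y)) = S r" for r y
        unfolding S_def by (intro sum.cong) (auto simp: walk_upd m_def)
      have S': "S' r = S r - drift (gram I v) c r s m * a / c" for r
      proof -
        have *: "(\<Sum>b\<in>I. v j b * \<theta>' b) = (\<Sum>b\<in>I. v j b * \<theta> b) - a / c * gram I v j m" for j
          by (simp add: \<theta>'_def gram_def algebra_simps sum_subtractf sum_distrib_left)
        show ?thesis
          unfolding S'_def S_def * drift_def lt
          by (simp add: right_diff_distrib sum_subtractf sum_distrib_left sum_distrib_right sum_divide_distrib ac_simps)
      qed
      \<comment> \<open>Only seed \<open>m\<close> is integrated here: \<open>S\<close>, the drift
        at \<open>m\<close> and aliveness up to \<open>m\<close> are determined by the earlier
        seeds.\<close>
      have inner: "(\<integral>\<^sup>+y. ennreal (exp (\<Sum>j\<in>{s<..m}. walk (gram I v) c (r(m := y)) s j * (\<Sum>b\<in>I. v j b * \<theta> b)))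
            * indicator {r. alive (gram I v) c r s m} (r(m := y)) \<partial>unif)
          \<le> ennreal (exp (a\<^sup>2 / 2)) * (ennreal (exp (S' r)) * indicator {r. alive (gram I v) c r s n} r)" for r
      proof (cases "alive (gram I v) c r s m")
        case False
        then show ?thesis by (simp add: alive_upd)
      next
        case True
        define D where "D = drift (gram I v) c r s m"
        have D: "\<bar>D\<bar> \<le> c" using True \<open>s < m\<close> by (auto simp: D_def alive_def)
        have an: "alive (gram I v) c r s n" using True by (auto simp: alive_def m_def)
        define q where "q = 1 / 2 - D / (2 * c)"
        have q: "0 \<le> q" "q \<le> 1" using D c by (auto simp: q_def field_simps)
        have "(\<integral>\<^sup>+y. ennreal (exp (\<Sum>j\<in>{s<..m}. walk (gram I v) c (r(m := y)) s j * (\<Sum>b\<in>I. v j b * \<theta> b)))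
            * indicator {r. alive (gram I v) c r s m} (r(m := y)) \<partial>unif)
          = (\<integral>\<^sup>+y. ennreal (if y \<le> q then exp (a + S r) else exp (- a + S r)) \<partial>unif)"
        proof (rule nn_integral_cong)
          fix y
          have "(\<Sum>j\<in>{s<..m}. walk (gram I v) c (r(m := y)) s j * (\<Sum>b\<in>I. v j b * \<theta> b))
              = walk (gram I v) c (r(m := y)) s m * a + S (r(m := y))"
            using split notin by (simp add: m_def[symmetric] a_def S_def)
          also have "walk (gram I v) c (r(m := y)) s m = (if y \<le> q then 1 else -1)"
            by (simp add: walk_eq drift_upd q_def D_def)
          also have "(if y \<le> q then 1 else -1) * a + S (r(m := y)) = (if y \<le> q then a + S r else - a + S r)"
            unfolding S_upd by simp
          finally have "(\<Sum>j\<in>{s<..m}. walk (gram I v) c (r(m := y)) s j * (\<Sum>b\<in>I. v j b * \<theta> b))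
              = (if y \<le> q then a + S r else - a + S r)" .
          then show "ennreal (exp (\<Sum>j\<in>{s<..m}. walk (gram I v) c (r(m := y)) s j * (\<Sum>b\<in>I. v j b * \<theta> b)))
              * indicator {r. alive (gram I v) c r s m} (r(m := y))
            = ennreal (if y \<le> q then exp (a + S r) else exp (- a + S r))"
            using True by (simp only: alive_upd indicator_def mem_Collect_eq) simp
        qed
        also have "\<dots> = ennreal (q * exp (a + S r) + (1 - q) * exp (- a + S r))"
          by (rule nn_integral_unif_threshold[OF q]) auto
        also have "q * exp (a + S r) + (1 - q) * exp (- a + S r)
            = (q * exp a + (1 - q) * exp (- a)) * exp (S r)"
          unfolding exp_add by (simp add: algebra_simps)
        also have "ennreal \<dots> \<le> ennreal (exp ((2 * q - 1) * a + a\<^sup>2 / 2) * exp (S r))"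
          by (intro ennreal_leI mult_right_mono two_point_mgf q) auto
        \<comment> \<open>Because 2q - 1 = -D / c, the mean of step \<open>m\<close> turns
          \<open>S\<close> into \<open>S'\<close>.\<close>
        also have "exp ((2 * q - 1) * a + a\<^sup>2 / 2) * exp (S r) = exp (a\<^sup>2 / 2) * exp (S' r)"
          using c by (simp add: S' q_def D_def field_simps flip: exp_add)
        also have "ennreal (exp (a\<^sup>2 / 2) * exp (S' r))
            = ennreal (exp (a\<^sup>2 / 2)) * (ennreal (exp (S' r)) * indicator {r. alive (gram I v) c r s n} r)"
          using an by (simp add: ennreal_mult)
        finally show ?thesis .
      qed
      have "(\<integral>\<^sup>+r. ennreal (exp (\<Sum>j\<in>{s<..m}. walk (gram I v) c r s j * (\<Sum>b\<in>I. v j b * \<theta> b)))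
            * indicator {r. alive (gram I v) c r s m} r \<partial>seed_space)
          = (\<integral>\<^sup>+r. (\<integral>\<^sup>+y. ennreal (exp (\<Sum>j\<in>{s<..m}. walk (gram I v) c (r(m := y)) s j * (\<Sum>b\<in>I. v j b * \<theta> b)))
            * indicator {r. alive (gram I v) c r s m} (r(m := y)) \<partial>unif) \<partial>seed_space)"
        unfolding seed_space_def
        by (rule nn_integral_PiM_resample)
           (auto intro: prob_space_unif simp flip: seed_space_def)
      also have "\<dots> \<le> (\<integral>\<^sup>+r. ennreal (exp (a\<^sup>2 / 2)) * (ennreal (exp (S' r)) * indicator {r. alive (gram I v) c r s n} r) \<partial>seed_space)"
        by (intro nn_integral_mono inner)
      also have "\<dots> = ennreal (exp (a\<^sup>2 / 2)) * (\<integral>\<^sup>+r. (ennreal (exp (S' r)) * indicator {r. alive (gram I v) c r s n} r) \<partial>seed_space)"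
        unfolding S'_def by (rule nn_integral_cmult) measurable
      also have "\<dots> \<le> ennreal (exp (a\<^sup>2 / 2)) * ennreal (exp (c * (\<Sum>b\<in>I. (\<theta>' b)\<^sup>2) / 2))"
        unfolding S'_def by (intro mult_left_mono Suc.IH) auto
      also have "\<dots> = ennreal (exp ((a\<^sup>2 + c * (\<Sum>b\<in>I. (\<theta>' b)\<^sup>2)) / 2))"
        by (simp add: add_divide_distrib flip: ennreal_mult exp_add)
      also have "\<dots> \<le> ennreal (exp (c * (\<Sum>b\<in>I. (\<theta> b)\<^sup>2) / 2))"
      proof -
        \<comment> \<open>The cross term removes 2 a^2 / c from the squared norm, and the last term
          gives back at most a^2 / c.\<close>
        have eq: "(\<Sum>b\<in>I. (\<theta>' b)\<^sup>2) = (\<Sum>b\<in>I. (\<theta> b)\<^sup>2) - 2 * a / c * a + (a / c)\<^sup>2 * (\<Sum>b\<in>I. (v m b)\<^sup>2)"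
        proof -
          have "(\<Sum>b\<in>I. (\<theta>' b)\<^sup>2)
              = (\<Sum>b\<in>I. (\<theta> b)\<^sup>2 - 2 * a / c * (v m b * \<theta> b) + (a / c)\<^sup>2 * (v m b)\<^sup>2)"
            unfolding \<theta>'_def by (intro sum.cong) (simp_all add: power2_eq_square algebra_simps)
          then show ?thesis
            by (simp only: sum.distrib sum_subtractf sum_distrib_left[symmetric] a_def[symmetric])
        qed
        have "(a / c)\<^sup>2 * (\<Sum>b\<in>I. (v m b)\<^sup>2) \<le> (a / c)\<^sup>2 * c"
          by (intro mult_left_mono vc) auto
        also have "\<dots> = a\<^sup>2 / c" using c by (simp add: power2_eq_square field_simps)
        finally have "(\<Sum>b\<in>I. (\<theta>' b)\<^sup>2) \<le> (\<Sum>b\<in>I. (\<theta> b)\<^sup>2) - a\<^sup>2 / c"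
          unfolding eq by (simp add: power2_eq_square)
        then have "c * (\<Sum>b\<in>I. (\<theta>' b)\<^sup>2) \<le> c * ((\<Sum>b\<in>I. (\<theta> b)\<^sup>2) - a\<^sup>2 / c)"
          using c by simp
        also have "\<dots> = c * (\<Sum>b\<in>I. (\<theta> b)\<^sup>2) - a\<^sup>2" using c by (simp add: field_simps)
        finally show ?thesis by (intro ennreal_leI) simp
      qed
      finally show ?thesis by (simp add: m_def)
    qed
  }
qed

section \<open>Sub-Gaussian tails of the walk and their union bound\<close>

text \<open>Chernoff bound: Markov's inequality for exp(l S) on the alive event, with the
  exponential moment from \<open>walk_mgf\<close> in direction l u.\<close>

lemma walk_tail_upper:
  fixes v :: "nat \<Rightarrow> 'b \<Rightarrow> real"
  assumes vc: "\<And>i. (\<Sum>b\<in>I. (v i b)\<^sup>2) \<le> c" and c: "c > 0"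
    and u: "(\<Sum>b\<in>I. (u b)\<^sup>2) \<le> R" and R: "R > 0" and h: "h \<ge> 0"
  shows "emeasure seed_space {r. alive (gram I v) c r s n \<and> h < (\<Sum>j\<in>{s<..n}. walk (gram I v) c r s j * (\<Sum>b\<in>I. v j b * u b))}
    \<le> ennreal (exp (- (h\<^sup>2 / (2 * c * R))))"
proof -
  \<comment> \<open>This is the minimiser of -l h + c l^2 R / 2.\<close>
  define l where "l = h / (c * R)"
  define S where "S r = (\<Sum>j\<in>{s<..n}. walk (gram I v) c r s j * (\<Sum>b\<in>I. v j b * u b))" for r
  have [measurable]: "S \<in> borel_measurable seed_space" unfolding S_def by measurable
  have l: "l \<ge> 0" using h c R by (simp add: l_def)
  have mgf: "(\<integral>\<^sup>+r. ennreal (exp (l * S r)) * indicator {r. alive (gram I v) c r s n} r \<partial>seed_space)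
      \<le> ennreal (exp (c * (l\<^sup>2 * R) / 2))"
  proof -
    have "(\<integral>\<^sup>+r. ennreal (exp (l * S r)) * indicator {r. alive (gram I v) c r s n} r \<partial>seed_space)
      \<le> ennreal (exp (c * (\<Sum>b\<in>I. (l * u b)\<^sup>2) / 2))"
      using walk_mgf[where v = v, OF vc c, where s = s and n = n and \<theta> = "\<lambda>b. l * u b"]
      by (simp add: S_def sum_distrib_left algebra_simps)
    also have "\<dots> \<le> ennreal (exp (c * (l\<^sup>2 * R) / 2))"
      using u c by (auto simp: power_mult_distrib simp flip: sum_distrib_left
          intro!: mult_left_mono ennreal_leI)
    finally show ?thesis .
  qed
  have "emeasure seed_space {r. alive (gram I v) c r s n \<and> S r > h}
      = (\<integral>\<^sup>+r. indicator {r. alive (gram I v) c r s n \<and> S r > h} r \<partial>seed_space)"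
    by (subst nn_integral_indicator) (auto intro!: sets_seed_Collect)
  also have "\<dots> \<le> (\<integral>\<^sup>+r. ennreal (exp (- l * h)) * (ennreal (exp (l * S r)) * indicator {r. alive (gram I v) c r s n} r) \<partial>seed_space)"
  proof (rule nn_integral_mono)
    fix r
    show "indicator {r. alive (gram I v) c r s n \<and> S r > h} r
      \<le> ennreal (exp (- l * h)) * (ennreal (exp (l * S r)) * indicator {r. alive (gram I v) c r s n} r)"
      using l by (auto simp: indicator_def simp flip: ennreal_mult exp_add
          intro!: mult_left_mono)
  qed
  also have "\<dots> = ennreal (exp (- l * h)) * (\<integral>\<^sup>+r. (ennreal (exp (l * S r)) * indicator {r. alive (gram I v) c r s n} r) \<partial>seed_space)"
    by (rule nn_integral_cmult) measurable
  also have "\<dots> \<le> ennreal (exp (- l * h)) * ennreal (exp (c * (l\<^sup>2 * R) / 2))"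
    by (intro mult_left_mono mgf) auto
  also have "\<dots> = ennreal (exp (- l * h + c * (l\<^sup>2 * R) / 2))"
    by (simp flip: ennreal_mult exp_add)
  also have "- l * h + c * (l\<^sup>2 * R) / 2 = - (h\<^sup>2 / (2 * c * R))"
    using c R by (simp add: l_def power2_eq_square field_simps)
  finally show ?thesis unfolding S_def .
qed

lemma walk_tail:
  fixes v :: "nat \<Rightarrow> 'b \<Rightarrow> real"
  assumes vc: "\<And>i. (\<Sum>b\<in>I. (v i b)\<^sup>2) \<le> c" and c: "c > 0"
    and u: "(\<Sum>b\<in>I. (u b)\<^sup>2) \<le> R" and R: "R > 0" and h: "h \<ge> 0"
  shows "emeasure seed_space {r. alive (gram I v) c r s n \<and> h < \<bar>\<Sum>j\<in>{s<..n}. walk (gram I v) c r s j * (\<Sum>b\<in>I. v j b * u b)\<bar>}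
    \<le> ennreal (2 * exp (- (h\<^sup>2 / (2 * c * R))))"
    (is "emeasure _ {r. ?A r \<and> h < \<bar>?S r\<bar>} \<le> ennreal (2 * ?e)")
proof -
  have m: "(\<Sum>j\<in>{s<..n}. walk (gram I v) c r s j * (\<Sum>b\<in>I. v j b * - u b)) = - ?S r" for r
    by (simp add: sum_negf)
  have "{r. ?A r \<and> \<bar>?S r\<bar> > h} = {r. ?A r \<and> ?S r > h} \<union> {r. ?A r \<and> - ?S r > h}"
    using h by (auto simp: abs_if)
  moreover have "Measurable.pred seed_space (\<lambda>r. ?A r \<and> ?S r > h)" "Measurable.pred seed_space (\<lambda>r. ?A r \<and> - ?S r > h)"
    by measurable
  ultimately have "emeasure seed_space {r. ?A r \<and> \<bar>?S r\<bar> > h}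
      \<le> emeasure seed_space {r. ?A r \<and> ?S r > h} + emeasure seed_space {r. ?A r \<and> - ?S r > h}"
    by (auto simp: pred_def intro!: emeasure_subadditive)
  also have "\<dots> \<le> ennreal ?e + ennreal ?e"
    using walk_tail_upper[where v = v, OF vc c u R h, where s = s and n = n]
      walk_tail_upper[where v = v, OF vc c, where u = "\<lambda>b. - u b" and R = R and h = h and s = s and n = n, unfolded m] u R h
    unfolding m by (intro add_mono) auto
  finally show ?thesis by (simp flip: ennreal_plus)
qed

text \<open>The drift is itself the walk tested against a vector, namely the next \<open>v\<close>,
  so the same tail bound controls aliveness. Each time thus has one bad event for the drift and
  \<open>card U\<close> for the test directions, each of probability at most 2e.\<close>

lemma walk_failure:
  fixes v :: "nat \<Rightarrow> 'b \<Rightarrow> real" and u :: "'u \<Rightarrow> 'b \<Rightarrow> real" and e :: real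
  assumes vR: "\<And>i. (\<Sum>b\<in>I. (v i b)\<^sup>2) \<le> R" and R: "0 < R" "R \<le> c"
    and fin: "finite U" and u: "\<And>a. a \<in> U \<Longrightarrow> (\<Sum>b\<in>I. (u a b)\<^sup>2) \<le> R'" and R': "R' > 0" and h: "h \<ge> 0"
    and e: "exp (- (c / (2 * R))) \<le> e" "exp (- (h\<^sup>2 / (2 * c * R'))) \<le> e"
  shows "emeasure seed_space {r. \<exists>n\<in>{s<..t}. \<exists>a\<in>U. h < \<bar>\<Sum>j\<in>{s<..n}. walk (gram I v) c r s j * (\<Sum>b\<in>I. v j b * u a b)\<bar>}
    \<le> ennreal (real t * ((1 + card U) * (2 * e)))"
    (is "emeasure _ ?bad \<le> _")
proof -
  have c: "c > 0" and vc: "\<And>i. (\<Sum>b\<in>I. (v i b)\<^sup>2) \<le> c"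
    using R order_trans[OF vR] by auto
  have e0: "e \<ge> 0" using e(1) exp_ge_zero order_trans by blast
  define T where "T w n = (\<lambda>r. \<Sum>j\<in>{s<..n}. walk (gram I v) c r s j * (\<Sum>b\<in>I. v j b * w b))" for w n
  \<comment> \<open>The drift at \<open>n\<close> depends on the walk up to \<open>n - 1\<close>, so
    aliveness up to \<open>n - 1\<close> is what the tail bound requires.\<close>
  define D where "D n = {r. alive (gram I v) c r s (n - 1) \<and> \<bar>T (v n) (n - 1) r\<bar> > c}" for n
  define E where "E n a = {r. alive (gram I v) c r s n \<and> \<bar>T (u a) n r\<bar> > h}" for n a
  have [measurable]: "T w n \<in> borel_measurable seed_space" for w n unfolding T_def by measurable
  have Dm[measurable]: "D n \<in> sets seed_space" for n
    unfolding D_def by (intro sets_seed_Collect) measurable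
  have Em[measurable]: "E n a \<in> sets seed_space" for n a
    unfolding E_def by (intro sets_seed_Collect) measurable
  have drift: "drift (gram I v) c r s n = T (v n) (n - 1) r" if "s < n" for n r
  proof -
    have "{s<..<n} = {s<..n - 1}" using that by auto
    then show ?thesis by (simp add: drift_def T_def gram_def)
  qed
  have sub: "?bad \<subseteq> (\<Union>n\<in>{s<..t}. D n \<union> (\<Union>a\<in>U. E n a))"
  proof
    fix r assume "r \<in> ?bad"
    then obtain n a where n: "n \<in> {s<..t}" "a \<in> U" "\<bar>T (u a) n r\<bar> > h" by (auto simp: T_def)
    show "r \<in> (\<Union>n\<in>{s<..t}. D n \<union> (\<Union>a\<in>U. E n a))"
    proof (cases "alive (gram I v) c r s n")
      case True
      then show ?thesis using n by (auto simp: E_def)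
    next
      case False
      \<comment> \<open>At the first time the drift leaves [-c, c] the walk was alive just before,
        which is the event \<open>D\<close> at that time.\<close>
      define P where "P i \<longleftrightarrow> i \<in> {s<..n} \<and> \<not> \<bar>drift (gram I v) c r s i\<bar> \<le> c" for i
      define m where "m = (LEAST i. P i)"
      have "\<exists>i. P i" using False by (auto simp: alive_def P_def)
      then have m: "P m" unfolding m_def by (rule LeastI_ex)
      have "\<not> P i" if "i < m" for i using that not_less_Least unfolding m_def by blast
      then have "alive (gram I v) c r s (m - 1)" using m by (auto simp: alive_def P_def)
      then have "r \<in> D m" using m by (auto simp: D_def P_def drift)
      moreover have "m \<in> {s<..t}" using m n by (auto simp: P_def)
      ultimately show ?thesis by auto
    qed
  qed
  have D: "emeasure seed_space (D n) \<le> ennreal (2 * e)" for n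
  proof -
    \<comment> \<open>The tail bound at height c in a direction of squared norm at most R has
      exponent c^2 / (2 c R) = c / (2 R).\<close>
    have "emeasure seed_space (D n) \<le> ennreal (2 * exp (- (c\<^sup>2 / (2 * c * R))))"
      unfolding D_def T_def by (rule walk_tail[where v = v, OF vc c]) (use vR R c in auto)
    also have "\<dots> \<le> ennreal (2 * e)"
      using c e(1) by (intro ennreal_leI) (simp add: power2_eq_square)
    finally show ?thesis .
  qed
  have E: "emeasure seed_space (E n a) \<le> ennreal (2 * e)" if "a \<in> U" for n a
  proof -
    have "emeasure seed_space (E n a) \<le> ennreal (2 * exp (- (h\<^sup>2 / (2 * c * R'))))"
      unfolding E_def T_def by (rule walk_tail[where v = v, OF vc c]) (use u[OF that] R' h in auto)
    also have "\<dots> \<le> ennreal (2 * e)" using e(2) by (intro ennreal_leI) auto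
    finally show ?thesis .
  qed
  have DE: "emeasure seed_space (D n \<union> (\<Union>a\<in>U. E n a)) \<le> ennreal ((1 + card U) * (2 * e))" for n
  proof -
    have "emeasure seed_space (D n \<union> (\<Union>a\<in>U. E n a))
        \<le> emeasure seed_space (D n) + (\<Sum>a\<in>U. emeasure seed_space (E n a))"
      using fin by (intro order_trans[OF emeasure_subadditive] add_mono emeasure_subadditive_finite) auto
    also have "\<dots> \<le> ennreal (2 * e) + (\<Sum>a\<in>U. ennreal (2 * e))"
      by (intro add_mono sum_mono D E)
    also have "\<dots> = ennreal ((1 + card U) * (2 * e))"
      using e0 by (simp add: ennreal_of_nat_eq_real_of_nat algebra_simps flip: ennreal_mult ennreal_plus)
    finally show ?thesis .
  qed
  have "emeasure seed_space ?bad \<le> emeasure seed_space (\<Union>n\<in>{s<..t}. D n \<union> (\<Union>a\<in>U. E n a))"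
    using fin by (intro emeasure_mono sub sets.finite_UN sets.Un Dm Em) auto
  also have "\<dots> \<le> (\<Sum>n\<in>{s<..t}. emeasure seed_space (D n \<union> (\<Union>a\<in>U. E n a)))"
    using fin by (intro emeasure_subadditive_finite) (auto intro!: sets.finite_UN sets.Un)
  also have "\<dots> \<le> (\<Sum>n\<in>{s<..t}. ennreal ((1 + card U) * (2 * e)))"
    by (intro sum_mono DE)
  also have "\<dots> = ennreal (real (t - s) * ((1 + card U) * (2 * e)))"
    using e0 by (simp add: ennreal_of_nat_eq_real_of_nat flip: ennreal_mult)
  also have "\<dots> \<le> ennreal (real t * ((1 + card U) * (2 * e)))"
    using e0 by (intro ennreal_leI mult_right_mono) auto
  finally show ?thesis .
qed

subsection \<open>Quantile cells\<close>

text \<open>A maximal set on which this is constant is a single point or an interval of mass at most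
  \<open>1 / N\<close>, whatever the atoms of \<open>p\<close>.\<close>

definition cell :: "(real ^ 'd::finite) measure \<Rightarrow> nat \<Rightarrow> 'd \<Rightarrow> real \<Rightarrow> nat" where
  "cell p N k a = nat \<lfloor>N * measure p {x. x $ k \<le> a}\<rfloor> + nat \<lfloor>N * measure p {x. x $ k < a}\<rfloor>"

context
  fixes p :: "(real ^ 'd::finite) measure"
  assumes p: "prob_space p" and sets_p: "sets p = sets borel"
begin

interpretation prob_space p by (rule p)

lemma space_p: "space p = UNIV"
  using sets_eq_imp_space_eq[OF sets_p] by simp

lemma slab_sets: "{x. x $ k \<le> a} \<in> sets p" "{x. x $ k < a} \<in> sets p"
  unfolding sets_p by measurable

lemma cell_mono: "mono (cell p N k)"
  unfolding cell_def
  by (intro monoI add_mono nat_mono floor_mono mult_left_mono finite_measure_mono slab_sets) auto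

lemma cell_le: "cell p N k a \<le> 2 * N"
proof -
  have "nat \<lfloor>N * measure p X\<rfloor> \<le> N" for X
  proof -
    have "N * measure p X \<le> real N * 1" by (intro mult_left_mono prob_le_1) auto
    then show ?thesis by linarith
  qed
  then show ?thesis unfolding cell_def mult_2 by (intro add_mono)
qed

lemma cell_measurable[measurable]: "cell p N k \<in> borel \<rightarrow>\<^sub>M count_space UNIV"
proof -
  have [measurable]: "(\<lambda>a. real (cell p N k a)) \<in> borel_measurable borel"
    by (intro borel_measurable_mono monoI) (use cell_mono in \<open>auto dest: monoD\<close>)
  have "cell p N k -` {m} \<inter> space borel \<in> sets borel" for m
  proof -
    have "cell p N k -` {m} \<inter> space borel = {a \<in> space borel. real (cell p N k a) = real m}" by auto
    also have "\<dots> \<in> sets borel" by measurable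
    finally show ?thesis .
  qed
  then show ?thesis by (simp add: measurable_count_space_eq2_countable)
qed

text \<open>For b < b' the floors interleave: g b \<le> f b \<le> g b' \<le> f b'. Equal sums
  therefore force all four to agree, so every other value in the cell of \<open>a\<close> lies in
  \<open>A\<close>, on which the distribution function gains at most 1/N. The value \<open>a\<close>
  is left out because it may be an atom of any mass.\<close>

lemma cell_collision:
  assumes N: "N > 0"
  shows "measure p {y. y $ k \<noteq> a \<and> cell p N k (y $ k) = cell p N k a} \<le> 1 / N"
proof -
  define F where "F b = measure p {x. x $ k \<le> b}" for b
  define G where "G b = measure p {x. x $ k < b}" for b
  define f where "f b = nat \<lfloor>N * F b\<rfloor>" for b
  define g where "g b = nat \<lfloor>N * G b\<rfloor>" for b
  define A where "A = {b. f b = f a \<and> g b = f a}"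
  have cell: "cell p N k b = f b + g b" for b by (simp add: cell_def f_def g_def F_def G_def)
  have gf: "g b \<le> f b" for b unfolding f_def g_def F_def G_def
    by (intro nat_mono floor_mono mult_left_mono finite_measure_mono slab_sets) auto
  have fg: "f b \<le> g b'" if "b < b'" for b b' unfolding f_def g_def F_def G_def
    by (intro nat_mono floor_mono mult_left_mono finite_measure_mono slab_sets) (use that in auto)
  have mono: "mono (\<lambda>b. real (f b))" "mono (\<lambda>b. real (g b))" unfolding f_def g_def F_def G_def
    by (intro monoI iffD2[OF of_nat_le_iff] nat_mono floor_mono mult_left_mono finite_measure_mono slab_sets; force)+
  have sub: "b \<in> A" if "b \<noteq> a" "cell p N k b = cell p N k a" for b
  proof -
    consider "b < a" | "a < b" using \<open>b \<noteq> a\<close> by linarith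
    then show ?thesis
    proof cases
      case 1
      then show ?thesis using fg[OF 1] gf[of a] gf[of b] that by (simp add: A_def cell)
    next
      case 2
      then show ?thesis using fg[OF 2] gf[of a] gf[of b] that by (simp add: A_def cell)
    qed
  qed
  have [measurable]: "A \<in> sets borel"
  proof -
    have [measurable]: "(\<lambda>b. real (f b)) \<in> borel_measurable borel" "(\<lambda>b. real (g b)) \<in> borel_measurable borel"
      by (intro borel_measurable_mono mono)+
    have "A = {b \<in> space borel. real (f b) = real (f a) \<and> real (g b) = real (f a)}" by (auto simp: A_def)
    also have "\<dots> \<in> sets borel" by measurable
    finally show ?thesis .
  qed
  define \<mu> where "\<mu> = distr p borel (\<lambda>x. x $ k)"
  have comp: "(\<lambda>x. x $ k) \<in> borel_measurable p"
    unfolding measurable_cong_sets[OF sets_p refl] by measurable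
  interpret \<mu>: prob_space \<mu> unfolding \<mu>_def by (rule prob_space_distr[OF comp])
  have \<mu>: "measure \<mu> X = measure p {x. x $ k \<in> X}" if "X \<in> sets borel" for X
    using that comp by (simp add: \<mu>_def measure_distr space_p vimage_def)
  \<comment> \<open>\<open>A\<close> may lack its endpoints. A compact subset attains its extremes
    \<open>lo\<close> and \<open>hi\<close>, both in \<open>A\<close>, so the equal floors bound its
    mass; inner regularity then reaches \<open>A\<close>.\<close>
  have K: "emeasure \<mu> K \<le> ennreal (1 / N)" if K: "K \<subseteq> A" "compact K" for K
  proof (cases "K = {}")
    case False
    obtain lo where lo: "lo \<in> K" "\<And>y. y \<in> K \<Longrightarrow> lo \<le> y" using compact_attains_inf[OF K(2) False] by auto
    obtain hi where hi: "hi \<in> K" "\<And>y. y \<in> K \<Longrightarrow> y \<le> hi" using compact_attains_sup[OF K(2) False] by auto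
    have "measure \<mu> K \<le> measure \<mu> {lo..hi}"
      using lo hi by (intro \<mu>.finite_measure_mono) (auto simp: \<mu>_def)
    also have "\<dots> = measure p ({x. x $ k \<le> hi} - {x. x $ k < lo})"
      by (subst \<mu>) (auto intro!: arg_cong[where f = "measure p"])
    also have "\<dots> = F hi - G lo"
      unfolding F_def G_def using lo(2)[OF hi(1)]
      by (intro finite_measure_Diff slab_sets) auto
    also have "\<dots> \<le> 1 / N"
    proof -
      have nn: "0 \<le> N * F hi" "0 \<le> N * G lo" by (auto simp: F_def G_def)
      have "f hi = f a" "g lo = f a" using lo(1) hi(1) K(1) unfolding A_def by blast+
      then have "f hi = g lo" by simp
      then have "nat \<lfloor>N * F hi\<rfloor> = nat \<lfloor>N * G lo\<rfloor>" by (simp only: f_def g_def)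
      then have "N * F hi - N * G lo \<le> 1" using nn by linarith
      then show ?thesis using N by (simp add: field_simps)
    qed
    finally show ?thesis by (simp add: \<mu>.emeasure_eq_measure ennreal_leI)
  qed auto
  have "measure p {y. y $ k \<noteq> a \<and> cell p N k (y $ k) = cell p N k a} \<le> measure p {x. x $ k \<in> A}"
  proof (intro finite_measure_mono)
    show "{x. x $ k \<in> A} \<in> sets p" using measurable_sets[OF comp, of A] by (simp add: space_p vimage_def)
  qed (use sub in auto)
  also have "\<dots> = measure \<mu> A" by (subst \<mu>) auto
  also have "\<dots> \<le> 1 / N"
  proof -
    have "emeasure \<mu> A = (SUP K\<in>{K. K \<subseteq> A \<and> compact K}. emeasure \<mu> K)"
      by (rule inner_regular) (simp_all add: \<mu>_def \<mu>.emeasure_finite[unfolded \<mu>_def])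
    also have "\<dots> \<le> ennreal (1 / N)" by (intro SUP_least) (use K in auto)
    finally show ?thesis by (simp add: \<mu>.emeasure_eq_measure)
  qed
  finally show ?thesis .
qed

end

subsection \<open>Dyadic decomposition\<close>

text \<open>The pair (l, m) stands for the integers from m 2^l up to but excluding (m + 1) 2^l. A
  range of \<open>m\<close> common to all levels makes the index set a product.\<close>

definition dyadic_index :: "nat \<Rightarrow> (nat \<times> nat) set" where
  "dyadic_index L = {..L} \<times> {..2 ^ Suc L}"

definition dyadic :: "nat \<Rightarrow> nat \<times> nat \<Rightarrow> real" where
  "dyadic q = (\<lambda>(l, m). of_bool (q div 2 ^ l = m))"

text \<open>If bit \<open>l\<close> of \<open>b\<close> is set, the block chosen at level
  \<open>l\<close> is the one ending just before \<open>b\<close> rounded down to a multiple of 2^l.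
  \<open>Suc m\<close> avoids truncated subtraction.\<close>

definition prefix_coeff :: "nat \<Rightarrow> nat \<times> nat \<Rightarrow> real" where
  "prefix_coeff b = (\<lambda>(l, m). of_bool (odd (b div 2 ^ l) \<and> Suc m = b div 2 ^ l))"

lemma sum_of_bool_eq_le_1: "finite A \<Longrightarrow> (\<Sum>m\<in>A. of_bool (P \<and> Suc m = n)) \<le> (1::real)"
proof -
  assume "finite A"
  have "(\<Sum>m\<in>A. of_bool (P \<and> Suc m = n)) \<le> (\<Sum>m\<in>A. if m = n - 1 then (1::real) else 0)"
    by (intro sum_mono) auto
  also have "\<dots> \<le> 1" using \<open>finite A\<close> by (simp add: sum.delta)
  finally show ?thesis .
qed

lemma prefix_coeff_norm: "(\<Sum>i\<in>dyadic_index L. (prefix_coeff b i)\<^sup>2) \<le> real (Suc L)"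
proof -
  have "(\<Sum>i\<in>dyadic_index L. (prefix_coeff b i)\<^sup>2)
      = (\<Sum>l\<le>L. \<Sum>m\<le>2 ^ Suc L. of_bool (odd (b div 2 ^ l) \<and> Suc m = b div 2 ^ l))"
    unfolding dyadic_index_def sum.cartesian_product'
    by (intro sum.cong refl) (simp add: prefix_coeff_def)
  also have "\<dots> \<le> (\<Sum>l\<le>L. 1)" by (intro sum_mono sum_of_bool_eq_le_1) auto
  finally show ?thesis by simp
qed

lemma dyadic_norm:
  assumes "q \<le> 2 ^ Suc L"
  shows "(\<Sum>i\<in>dyadic_index L. (dyadic q i)\<^sup>2) = real (Suc L)"
proof -
  have le: "q div 2 ^ l \<le> 2 ^ Suc L" for l using assms div_le_dividend le_trans by blast
  have "(\<Sum>i\<in>dyadic_index L. (dyadic q i)\<^sup>2) = (\<Sum>l\<le>L. \<Sum>m\<le>2 ^ Suc L. of_bool (q div 2 ^ l = m))"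
    unfolding dyadic_index_def sum.cartesian_product'
    by (intro sum.cong refl) (simp add: dyadic_def)
  also have "\<dots> = (\<Sum>l\<le>L. 1)"
    using le by (intro sum.cong refl) (simp add: of_bool_def sum.delta)
  finally show ?thesis by simp
qed

text \<open>The binary expansion of \<open>b\<close> splits \<open>{..<b}\<close> into disjoint dyadic intervals, at most one per
  level; the sum over the levels telescopes.\<close>

lemma prefix_decomposition:
  assumes b: "b < 2 ^ Suc L" and q: "q \<le> 2 ^ Suc L"
  shows "(\<Sum>i\<in>dyadic_index L. dyadic q i * prefix_coeff b i) = of_bool (q < b)"
proof -
  define f :: "nat \<Rightarrow> real" where "f l = of_bool (q div 2 ^ l < b div 2 ^ l)" for l
  have le: "q div 2 ^ l \<le> 2 ^ Suc L" for l using q div_le_dividend le_trans by blast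
  \<comment> \<open>The block of \<open>q\<close> precedes that of \<open>b\<close> at level
    \<open>l\<close> but not at level \<open>l + 1\<close> exactly when the two blocks are the
    halves of one parent block.\<close>
  have step: "of_bool (odd (b div 2 ^ l) \<and> Suc (q div 2 ^ l) = b div 2 ^ l) = f l - f (Suc l)" for l
  proof -
    have "of_bool (odd b' \<and> Suc q' = b') = of_bool (q' < b') - (of_bool (q' div 2 < b' div 2) :: real)" for b' q' :: nat
    proof (cases "q' div 2 < b' div 2")
      case True
      then show ?thesis by (auto simp: of_bool_def)
    next
      case False
      then have "(odd b' \<and> Suc q' = b') \<longleftrightarrow> q' < b'" by presburger
      with False show ?thesis by simp
    qed
    then show ?thesis by (simp add: f_def div_mult2_eq mult.commute flip: div_mult2_eq)
  qed
  have "(\<Sum>i\<in>dyadic_index L. dyadic q i * prefix_coeff b i)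
      = (\<Sum>l\<le>L. \<Sum>m\<le>2 ^ Suc L. of_bool (q div 2 ^ l = m) * of_bool (odd (b div 2 ^ l) \<and> Suc m = b div 2 ^ l))"
    unfolding dyadic_index_def sum.cartesian_product'
    by (intro sum.cong refl) (simp add: dyadic_def prefix_coeff_def)
  also have "\<dots> = (\<Sum>l\<le>L. f l - f (Suc l))"
  proof (intro sum.cong refl)
    fix l
    have "(\<Sum>m\<le>2 ^ Suc L. of_bool (q div 2 ^ l = m) * of_bool (odd (b div 2 ^ l) \<and> Suc m = b div 2 ^ l))
       = (\<Sum>m\<le>2 ^ Suc L. if m = q div 2 ^ l then of_bool (odd (b div 2 ^ l) \<and> Suc (q div 2 ^ l) = b div 2 ^ l) else (0::real))"
      by (intro sum.cong refl) auto
    also have "\<dots> = of_bool (odd (b div 2 ^ l) \<and> Suc (q div 2 ^ l) = b div 2 ^ l)"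
      using le[of l] by (simp only: sum.delta finite_atMost) simp
    finally show "(\<Sum>m\<le>2 ^ Suc L. of_bool (q div 2 ^ l = m) * of_bool (odd (b div 2 ^ l) \<and> Suc m = b div 2 ^ l))
       = f l - f (Suc l)" unfolding step .
  qed
  also have "\<dots> = f 0 - f (Suc L)" by (rule sum_telescope)
  \<comment> \<open>The strict bound on \<open>b\<close> makes \<open>f (Suc L)\<close>
    vanish.\<close>
  also have "\<dots> = of_bool (q < b)" using b by (simp add: f_def)
  finally show ?thesis .
qed

section \<open>Tensor products over the coordinates\<close>

definition box_index :: "nat \<Rightarrow> ('d::finite \<Rightarrow> nat \<times> nat) set" where
  "box_index L = PiE UNIV (\<lambda>_. dyadic_index L)"

definition box_feature :: "('d::finite \<Rightarrow> nat) \<Rightarrow> ('d \<Rightarrow> nat \<times> nat) \<Rightarrow> real" where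
  "box_feature q g = (\<Prod>k\<in>UNIV. dyadic (q k) (g k))"

text \<open>A tensor product of differences of two prefixes, representing the half-open box with
  lower corner \<open>a\<close> and upper corner \<open>b\<close>. Pairing the corners lets them
  serve as one index in the union bound.\<close>

definition box_coeff :: "('d::finite \<Rightarrow> nat) \<times> ('d \<Rightarrow> nat) \<Rightarrow> ('d \<Rightarrow> nat \<times> nat) \<Rightarrow> real" where
  "box_coeff = (\<lambda>(a, b) g. \<Prod>k\<in>UNIV. prefix_coeff (b k) (g k) - prefix_coeff (a k) (g k))"

lemma finite_dyadic_index[simp]: "finite (dyadic_index L)"
  by (simp add: dyadic_index_def)

lemma box_feature_norm:
  fixes q :: "'d::finite \<Rightarrow> nat"
  assumes "\<And>k. q k \<le> 2 ^ Suc L"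
  shows "(\<Sum>g\<in>box_index L. (box_feature q g)\<^sup>2) = real (Suc L) ^ CARD('d)"
  unfolding box_index_def box_feature_def prod_power_distrib
  by (subst prod_sum_PiE[symmetric]) (simp_all only: finite_dyadic_index dyadic_norm assms prod_constant finite)

text \<open>The sum of squares factorises over the coordinates. In each of them (x - y)^2 \<le> 2
  x^2 + 2 y^2, and a prefix has squared norm at most L + 1.\<close>

lemma box_coeff_norm:
  fixes ab :: "('d::finite \<Rightarrow> nat) \<times> ('d \<Rightarrow> nat)"
  shows "(\<Sum>g\<in>box_index L. (box_coeff ab g)\<^sup>2) \<le> (4 * real (Suc L)) ^ CARD('d)"
proof -
  obtain a b where ab: "ab = (a, b)" by force
  have "(\<Sum>i\<in>dyadic_index L. (prefix_coeff (b k) i - prefix_coeff (a k) i)\<^sup>2) \<le> 4 * real (Suc L)" for k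
  proof -
    have *: "(x - y)\<^sup>2 \<le> 2 * x\<^sup>2 + 2 * y\<^sup>2" for x y :: real
      using zero_le_power2[of "x + y"] by (simp add: power2_eq_square algebra_simps)
    have "(\<Sum>i\<in>dyadic_index L. (prefix_coeff (b k) i - prefix_coeff (a k) i)\<^sup>2)
      \<le> (\<Sum>i\<in>dyadic_index L. 2 * (prefix_coeff (b k) i)\<^sup>2 + 2 * (prefix_coeff (a k) i)\<^sup>2)"
      by (intro sum_mono *)
    also have "\<dots> = 2 * (\<Sum>i\<in>dyadic_index L. (prefix_coeff (b k) i)\<^sup>2) + 2 * (\<Sum>i\<in>dyadic_index L. (prefix_coeff (a k) i)\<^sup>2)"
      by (simp add: sum.distrib sum_distrib_left)
    also have "\<dots> \<le> 2 * real (Suc L) + 2 * real (Suc L)"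
      by (intro add_mono mult_left_mono prefix_coeff_norm) auto
    finally show ?thesis by simp
  qed
  then have "(\<Prod>k\<in>(UNIV::'d set). \<Sum>i\<in>dyadic_index L. (prefix_coeff (b k) i - prefix_coeff (a k) i)\<^sup>2)
      \<le> (\<Prod>k\<in>(UNIV::'d set). 4 * real (Suc L))"
    by (intro prod_mono) (auto intro: sum_nonneg)
  then show ?thesis
    unfolding ab box_index_def box_coeff_def split prod_power_distrib
    by (subst prod_sum_PiE[symmetric]) simp_all
qed

text \<open>Distributivity turns the sum over multi-indices into a product of one-dimensional prefix
  differences, each the indicator of a half-open interval.\<close>

lemma box_decomposition:
  fixes a b q :: "'d::finite \<Rightarrow> nat"
  assumes q: "\<And>k. q k \<le> 2 ^ Suc L" and b: "\<And>k. b k < 2 ^ Suc L" and ab: "\<And>k. a k \<le> b k"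
  shows "(\<Sum>g\<in>box_index L. box_feature q g * box_coeff (a, b) g) = of_bool (\<forall>k. a k \<le> q k \<and> q k < b k)"
proof -
  have a: "a k < 2 ^ Suc L" for k using ab[of k] b[of k] by linarith
  have "(\<Sum>g\<in>box_index L. box_feature q g * box_coeff (a, b) g)
      = (\<Prod>k\<in>UNIV. \<Sum>i\<in>dyadic_index L. dyadic (q k) i * (prefix_coeff (b k) i - prefix_coeff (a k) i))"
    unfolding box_index_def box_coeff_def box_feature_def split prod.distrib[symmetric]
    by (subst prod_sum_PiE) simp_all
  also have "\<dots> = (\<Prod>k\<in>UNIV. of_bool (a k \<le> q k \<and> q k < b k))"
  proof (intro prod.cong refl)
    fix k
    show "(\<Sum>i\<in>dyadic_index L. dyadic (q k) i * (prefix_coeff (b k) i - prefix_coeff (a k) i))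
        = of_bool (a k \<le> q k \<and> q k < b k)"
      using ab[of k] unfolding right_diff_distrib sum_subtractf prefix_decomposition[OF b q] prefix_decomposition[OF a q]
      by (auto simp: of_bool_def)
  qed
  also have "\<dots> = of_bool (\<forall>k. a k \<le> q k \<and> q k < b k)"
  proof (cases "\<forall>k. a k \<le> q k \<and> q k < b k")
    case False
    then obtain k where "\<not> (a k \<le> q k \<and> q k < b k)" by blast
    then have "(\<Prod>k\<in>UNIV. of_bool (a k \<le> q k \<and> q k < b k)) = (0::real)"
      by (intro prod_zero) (auto intro!: bexI[of _ k])
    with False show ?thesis by simp
  qed simp
  finally show ?thesis .
qed

subsection \<open>Boxes and finite point sets\<close>

definition grid_boxes :: "nat \<Rightarrow> (('d::finite \<Rightarrow> nat) \<times> ('d \<Rightarrow> nat)) set" where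
  "grid_boxes n = (UNIV \<rightarrow>\<^sub>E {..<n}) \<times> (UNIV \<rightarrow>\<^sub>E {..<n})"

lemma finite_grid_boxes: "finite (grid_boxes n)"
  by (auto simp: grid_boxes_def intro!: finite_cartesian_product finite_PiE)

lemma card_grid_boxes: "card (grid_boxes n :: (('d::finite \<Rightarrow> nat) \<times> ('d \<Rightarrow> nat)) set) = n ^ (2 * CARD('d))"
  by (simp add: grid_boxes_def card_cartesian_product card_PiE mult_2 power_add)

text \<open>The grid box is the bounding box of the cells met by the points of \<open>B\<close>. A
  point in it has each coordinate between those of two points of \<open>B\<close>, and convexity of
  the sides puts it in \<open>B\<close>. The upper corner is one past the largest cell, hence
  \<open>Suc\<close> in the bound by \<open>n\<close>.\<close>

lemma box_eq_grid_box:
  fixes x :: "nat \<Rightarrow> real ^ 'd::finite" and f :: "'d \<Rightarrow> real \<Rightarrow> nat"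
  assumes mono: "\<And>k. mono (f k)" and lt: "\<And>k y. Suc (f k y) < n"
    and inj: "\<And>i j k. i \<in> T \<Longrightarrow> j \<in> T \<Longrightarrow> f k (x i $ k) = f k (x j $ k) \<Longrightarrow> x i $ k = x j $ k"
    and fin: "finite T" and B: "axis_parallel_box B"
  obtains a b where "(a, b) \<in> grid_boxes n" "\<And>k. a k \<le> b k"
    "\<And>j. j \<in> T \<Longrightarrow> x j \<in> B \<longleftrightarrow> (\<forall>k. a k \<le> f k (x j $ k) \<and> f k (x j $ k) < b k)"
proof -
  obtain I where I: "\<And>k. is_interval (I k)" "B = {y. \<forall>k. y $ k \<in> I k}"
    using B by (auto simp: axis_parallel_box_def)
  define S where "S = {j \<in> T. x j \<in> B}"
  have finS: "finite S" using fin by (simp add: S_def)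
  show ?thesis
  proof (cases "S = {}")
    \<comment> \<open>Without points in \<open>B\<close>, equal corners give the empty grid
      box.\<close>
    case True
    have "0 < n" using lt[of undefined undefined] by simp
    then have "((\<lambda>_. 0), (\<lambda>_. 0)) \<in> grid_boxes n" by (auto simp: grid_boxes_def)
    then show ?thesis by (rule that) (use True in \<open>auto simp: S_def\<close>)
  next
    case False
    define a where "a k = Min ((\<lambda>j. f k (x j $ k)) ` S)" for k
    define b where "b k = Suc (Max ((\<lambda>j. f k (x j $ k)) ` S))" for k
    have a: "\<exists>i\<in>S. a k = f k (x i $ k)" for k
    proof -
      have "a k \<in> (\<lambda>j. f k (x j $ k)) ` S" unfolding a_def using finS False by (intro Min_in) auto
      then show ?thesis by blast
    qed
    have b: "\<exists>i\<in>S. b k = Suc (f k (x i $ k))" for k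
    proof -
      have "Max ((\<lambda>j. f k (x j $ k)) ` S) \<in> (\<lambda>j. f k (x j $ k)) ` S" using finS False by (intro Max_in) auto
      then show ?thesis unfolding b_def by blast
    qed
    have bounds: "a k \<le> f k (x j $ k)" "f k (x j $ k) < b k" if "j \<in> S" for j k
      using that finS by (auto simp: a_def b_def less_Suc_eq_le)
    \<comment> \<open>A monotone map that separates distinct coordinates reflects their
      order.\<close>
    have le: "x i $ k \<le> x j $ k" if "i \<in> T" "j \<in> T" "f k (x i $ k) \<le> f k (x j $ k)" for i j k
    proof (rule ccontr)
      assume "\<not> ?thesis"
      moreover from this have "f k (x j $ k) \<le> f k (x i $ k)" by (intro monoD[OF mono]) simp
      ultimately show False using inj[OF that(1,2), of k] that(3) by simp
    qed
    have "(a, b) \<in> grid_boxes n"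
    proof -
      have "a k < n" "b k < n" for k
        using a[of k] b[of k] lt Suc_lessD by (metis, metis)
      then show ?thesis by (auto simp: grid_boxes_def)
    qed
    moreover have "a k \<le> b k" for k
      using False bounds[of _ k] by (meson all_not_in_conv le_trans less_imp_le)
    moreover have "x j \<in> B \<longleftrightarrow> (\<forall>k. a k \<le> f k (x j $ k) \<and> f k (x j $ k) < b k)" if j: "j \<in> T" for j
    proof
      assume "x j \<in> B"
      then show "\<forall>k. a k \<le> f k (x j $ k) \<and> f k (x j $ k) < b k" using bounds j by (auto simp: S_def)
    next
      assume *: "\<forall>k. a k \<le> f k (x j $ k) \<and> f k (x j $ k) < b k"
      have "x j $ k \<in> I k" for k
      proof -
        obtain i where i: "i \<in> S" "a k = f k (x i $ k)" using a by blast
        obtain i' where i': "i' \<in> S" "b k = Suc (f k (x i' $ k))" using b by blast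
        have "x i $ k \<le> x j $ k" by (rule le) (use i j *[rule_format, of k] in \<open>auto simp: S_def\<close>)
        moreover have "x j $ k \<le> x i' $ k" by (rule le) (use i' j *[rule_format, of k] in \<open>auto simp: S_def less_Suc_eq_le\<close>)
        moreover have "x i $ k \<in> I k" "x i' $ k \<in> I k" using i i' by (auto simp: S_def I(2))
        ultimately show ?thesis using I(1)[of k] by (meson is_interval_1)
      qed
      then show "x j \<in> B" by (simp add: I(2))
    qed
    ultimately show ?thesis by (rule that)
  qed
qed

section \<open>Measurability of the discrepancy event\<close>

definition exceeds :: "nat set \<Rightarrow> (nat \<Rightarrow> real) \<Rightarrow> (nat \<Rightarrow> real ^ 'd::finite) \<Rightarrow> real \<Rightarrow> bool" where
  "exceeds T e x h \<longleftrightarrow> (\<exists>B. axis_parallel_box B \<and> B \<subseteq> cbox 0 1 \<and> h < \<bar>\<Sum>j\<in>T. e j * indicator B (x j)\<bar>)"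

text \<open>Only the bounding boxes of subsets of the points matter, which turns the quantifier over all
  boxes into a finite one and makes the predicate measurable.\<close>

lemma exceeds_iff:
  fixes x :: "nat \<Rightarrow> real ^ 'd::finite"
  assumes fin: "finite T"
  shows "exceeds T e x h \<longleftrightarrow> (\<exists>J\<in>Pow T. (\<forall>j\<in>J. x j \<in> cbox 0 1) \<and>
    (\<forall>j\<in>T - J. \<exists>k. (\<forall>i\<in>J. x j $ k < x i $ k) \<or> (\<forall>i\<in>J. x i $ k < x j $ k)) \<and> h < \<bar>\<Sum>j\<in>J. e j\<bar>)"
    (is "_ \<longleftrightarrow> (\<exists>J\<in>Pow T. ?P J)")
proof
  assume "exceeds T e x h"
  then obtain B where B: "axis_parallel_box B" "B \<subseteq> cbox 0 1" "h < \<bar>\<Sum>j\<in>T. e j * indicator B (x j)\<bar>"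
    by (auto simp: exceeds_def)
  obtain I where I: "\<And>k. is_interval (I k)" "B = {y. \<forall>k. y $ k \<in> I k}"
    using B by (auto simp: axis_parallel_box_def)
  define J where "J = {j \<in> T. x j \<in> B}"
  have "(\<Sum>j\<in>T. e j * indicator B (x j)) = (\<Sum>j\<in>J. e j)"
    using fin by (simp add: J_def indicator_def sum.If_cases if_distrib Int_def cong: if_cong)
  moreover have "\<exists>k. (\<forall>i\<in>J. x j $ k < x i $ k) \<or> (\<forall>i\<in>J. x i $ k < x j $ k)" if j: "j \<in> T - J" for j
  proof -
    from j obtain k where k: "x j $ k \<notin> I k" by (auto simp: J_def I(2))
    \<comment> \<open>Otherwise coordinate \<open>k\<close> of the outside point would lie between
      two elements of the interval \<open>I k\<close>, hence in it.\<close>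
    have "(\<forall>i\<in>J. x j $ k < x i $ k) \<or> (\<forall>i\<in>J. x i $ k < x j $ k)"
    proof (rule ccontr)
      assume "\<not> ?thesis"
      then obtain i i' where ii: "i \<in> J" "i' \<in> J" "x i $ k \<le> x j $ k" "x j $ k \<le> x i' $ k" by (auto simp: not_less)
      then have "x i $ k \<in> I k" "x i' $ k \<in> I k" by (auto simp: J_def I(2))
      then show False using ii k I(1)[of k] by (meson is_interval_1)
    qed
    then show ?thesis by blast
  qed
  ultimately have "?P J" using B by (auto simp: J_def)
  then show "\<exists>J\<in>Pow T. ?P J" by (intro bexI[of _ J]) (auto simp: J_def)
next
  assume "\<exists>J\<in>Pow T. ?P J"
  then obtain J where J: "J \<subseteq> T" "?P J" by auto
  have finJ: "finite J" using J fin finite_subset by auto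
  \<comment> \<open>The bounding box of the selected points. An empty selection is treated apart
    because \<open>Min\<close> and \<open>Max\<close> of the empty set are unspecified.\<close>
  define I where "I k = (if J = {} then {} else {Min ((\<lambda>i. x i $ k) ` J)..Max ((\<lambda>i. x i $ k) ` J)})" for k
  define B where "B = {y :: real ^ 'd. \<forall>k. y $ k \<in> I k}"
  have memB: "y \<in> B \<longleftrightarrow> J \<noteq> {} \<and> (\<forall>k. Min ((\<lambda>i. x i $ k) ` J) \<le> y $ k \<and> y $ k \<le> Max ((\<lambda>i. x i $ k) ` J))" for y
    by (cases "J = {}") (simp_all add: B_def I_def)
  have box: "axis_parallel_box B"
    unfolding axis_parallel_box_def by (intro exI[of _ I]) (auto simp: B_def I_def is_interval_cc)
  have sub: "B \<subseteq> cbox 0 1"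
  proof (cases "J = {}")
    case True
    then show ?thesis by (simp add: memB subset_iff)
  next
    case False
    have *: "\<forall>i\<in>J. 0 \<le> x i $ k \<and> x i $ k \<le> 1" for k using J(2) by (auto simp: mem_box_cart)
    have "0 \<le> Min ((\<lambda>i. x i $ k) ` J)" "Max ((\<lambda>i. x i $ k) ` J) \<le> 1" for k
      using *[of k] finJ False by auto
    moreover have "Min ((\<lambda>i. x i $ k) ` J) \<le> y $ k" "y $ k \<le> Max ((\<lambda>i. x i $ k) ` J)" if "y \<in> B" for y k
      using that unfolding memB by blast+
    ultimately show ?thesis unfolding subset_iff mem_box_cart zero_index one_index by (meson order_trans)
  qed
  have mem: "x j \<in> B \<longleftrightarrow> j \<in> J" if "j \<in> T" for j
  proof
    assume "j \<in> J"
    then show "x j \<in> B" unfolding memB using finJ by (metis Max_ge Min_le empty_iff finite_imageI imageI)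
  next
    assume jB: "x j \<in> B"
    then have ne: "J \<noteq> {}" unfolding memB by blast
    show "j \<in> J"
    proof (rule ccontr)
      assume "j \<notin> J"
      then have "j \<in> T - J" using that by simp
      with J(2) obtain k where k: "(\<forall>i\<in>J. x j $ k < x i $ k) \<or> (\<forall>i\<in>J. x i $ k < x j $ k)" by metis
      have "Min ((\<lambda>i. x i $ k) ` J) \<le> x j $ k" "x j $ k \<le> Max ((\<lambda>i. x i $ k) ` J)"
        using jB unfolding memB by blast+
      then have "\<exists>i\<in>J. x i $ k \<le> x j $ k" "\<exists>i\<in>J. x j $ k \<le> x i $ k"
        using finJ ne by (simp_all add: Min_le_iff Max_ge_iff)
      then show False using k leD by blast
    qed
  qed
  have "(\<Sum>j\<in>T. e j * indicator B (x j)) = (\<Sum>j\<in>T. if j \<in> J then e j else 0)"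
    by (intro sum.cong refl) (auto simp: mem indicator_def)
  also have "\<dots> = (\<Sum>j\<in>J. e j)"
    using J fin by (simp add: sum.If_cases Int_absorb1)
  finally have "h < \<bar>\<Sum>j\<in>T. e j * indicator B (x j)\<bar>" using J(2) by simp
  then show "exceeds T e x h" using box sub unfolding exceeds_def by blast
qed

lemma exceeds_cong:
  assumes "\<And>j. j \<in> T \<Longrightarrow> e j = e' j" "\<And>j. j \<in> T \<Longrightarrow> x j = x' j"
  shows "exceeds T e x h \<longleftrightarrow> exceeds T e' x' h"
proof -
  have "(\<Sum>j\<in>T. e j * indicator B (x j)) = (\<Sum>j\<in>T. e' j * indicator B (x' j))" for B
    by (intro sum.cong) (simp_all add: assms)
  then show ?thesis by (simp add: exceeds_def)
qed

lemma exceeds_measurable: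
  fixes x :: "'a \<Rightarrow> nat \<Rightarrow> real ^ 'd::finite"
  assumes fin: "finite T"
    and e: "\<And>j. j \<in> T \<Longrightarrow> (\<lambda>\<omega>. e \<omega> j) \<in> borel_measurable M"
    and x: "\<And>j. j \<in> T \<Longrightarrow> (\<lambda>\<omega>. x \<omega> j) \<in> borel_measurable M"
  shows "Measurable.pred M (\<lambda>\<omega>. exceeds T (e \<omega>) (x \<omega>) h)"
  unfolding exceeds_iff[OF fin]
proof (rule pred_intros_finite)
  show "finite (Pow T)" using fin by simp
next
  fix J assume J: "J \<in> Pow T"
  have finJ: "finite J" using J fin finite_subset by auto
  have xk: "(\<lambda>\<omega>. x \<omega> j $ k) \<in> borel_measurable M" if "j \<in> T" for j k
    by (rule measurable_compose[OF x[OF that]]) measurable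
  have [measurable]: "(\<lambda>\<omega>. \<Sum>j\<in>J. e \<omega> j) \<in> borel_measurable M"
    by (intro borel_measurable_sum e) (use J in auto)
  have lt: "Measurable.pred M (\<lambda>\<omega>. x \<omega> i $ k < x \<omega> j $ k)" if "i \<in> T" "j \<in> T" for i j k
    using xk[OF that(1)] xk[OF that(2)] by measurable
  have "Measurable.pred M (\<lambda>\<omega>. \<forall>j\<in>J. x \<omega> j \<in> cbox 0 1)"
    by (intro pred_intros_finite finJ pred_sets2[OF _ x]) (use J in auto)
  moreover have "Measurable.pred M (\<lambda>\<omega>. \<forall>j\<in>T - J. \<exists>k. (\<forall>i\<in>J. x \<omega> j $ k < x \<omega> i $ k) \<or> (\<forall>i\<in>J. x \<omega> i $ k < x \<omega> j $ k))"
    by (intro pred_intros_finite(3) pred_intros_countable(2) pred_intros_logic finJ finite_Diff fin lt)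
       (use J in auto)
  moreover have "Measurable.pred M (\<lambda>\<omega>. h < \<bar>\<Sum>j\<in>J. e \<omega> j\<bar>)" by measurable
  ultimately show "Measurable.pred M (\<lambda>\<omega>. (\<forall>j\<in>J. x \<omega> j \<in> cbox 0 1) \<and>
      (\<forall>j\<in>T - J. \<exists>k. (\<forall>i\<in>J. x \<omega> j $ k < x \<omega> i $ k) \<or> (\<forall>i\<in>J. x \<omega> i $ k < x \<omega> j $ k)) \<and> h < \<bar>\<Sum>j\<in>J. e \<omega> j\<bar>)"
    by (intro pred_intros_logic)
qed

subsection \<open>The walk at a fixed level\<close>

text \<open>The exponent E of the tail bounds. With n = 2^(\<kappa>+2) it satisfies 2^E = n^(2d+2):
  the part n^(2d) pays for the grid boxes and n^2 is left over.\<close>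

definition rate :: "nat \<Rightarrow> nat \<Rightarrow> nat" where
  "rate d \<kappa> = (2 * d + 2) * (\<kappa> + 2)"

text \<open>With R = (\<kappa>+2)^d, the squared norm of a feature vector, this is c = 2 R E, so
  that c / (2 R) = E.\<close>

definition clip :: "nat \<Rightarrow> nat \<Rightarrow> real" where
  "clip d \<kappa> = 2 * real (\<kappa> + 2) ^ d * real (rate d \<kappa>)"

text \<open>The solution h of h^2 / (2 c R') = E for c = 2 R E and R' = 4^d R, the bound for the
  squared norm of a box coefficient vector.\<close>

definition threshold :: "nat \<Rightarrow> nat \<Rightarrow> real" where
  "threshold d \<kappa> = 2 ^ (d + 1) * real (\<kappa> + 2) ^ d * real (rate d \<kappa>)"

lemma threshold_nonneg: "0 \<le> threshold d \<kappa>"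
  by (simp add: threshold_def)

definition point_feature ::
  "(real ^ 'd::finite) measure \<Rightarrow> nat \<Rightarrow> real ^ 'd \<Rightarrow> ('d \<Rightarrow> nat \<times> nat) \<Rightarrow> real" where
  "point_feature p \<kappa> y = box_feature (\<lambda>k. cell p (2 ^ \<kappa>) k (y $ k))"

text \<open>Cells go up to 2^(\<kappa>+1) and upper corners one further, all below 2^(\<kappa>+2).
  Therefore the dyadic levels run up to \<open>Suc \<kappa>\<close>.\<close>

definition level_walk ::
  "(real ^ 'd::finite) measure \<Rightarrow> nat \<Rightarrow> (nat \<Rightarrow> real ^ 'd) \<Rightarrow> (nat \<Rightarrow> real) \<Rightarrow> nat \<Rightarrow> nat \<Rightarrow> real" where
  "level_walk p \<kappa> x r s =
     walk (gram (box_index (Suc \<kappa>)) (\<lambda>j. point_feature p \<kappa> (x j))) (clip CARD('d) \<kappa>) r s"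

lemma level_walk_cases: "level_walk p \<kappa> x r s i \<in> {-1, 1}"
  unfolding level_walk_def by (rule walk_cases)

lemma level_walk_cong:
  assumes "\<And>j. s < j \<Longrightarrow> j \<le> i \<Longrightarrow> x j = x' j" and "s < i"
  shows "level_walk p \<kappa> x r s i = level_walk p \<kappa> x' r s i"
  unfolding level_walk_def by (rule walk_cong) (use assms in \<open>auto simp: gram_def\<close>)

definition collision :: "(real ^ 'd::finite) measure \<Rightarrow> nat \<Rightarrow> nat set \<Rightarrow> (nat \<Rightarrow> real ^ 'd) \<Rightarrow> bool" where
  "collision p N T x \<longleftrightarrow>
     (\<exists>i\<in>T. \<exists>j\<in>T. \<exists>k. x j $ k \<noteq> x i $ k \<and> cell p N k (x j $ k) = cell p N k (x i $ k))"

lemma collision_mono: "S \<subseteq> T \<Longrightarrow> collision p N S x \<Longrightarrow> collision p N T x"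
  unfolding collision_def by blast

text \<open>With M = n^(2d) the left side is 2 (1 + M) / (M n^2) \<le> 4 / n^2, and n^2 is at least
  4 times 2^\<kappa>.\<close>

lemma failure_arith:
  fixes \<kappa> d :: nat
  defines "n \<equiv> (2::nat) ^ (\<kappa> + 2)"
  shows "(1 + real (n ^ (2 * d))) * (2 * (1 / 2 ^ rate d \<kappa>)) \<le> 1 / 2 ^ \<kappa>"
proof -
  define M where "M = real n ^ (2 * d)"
  have "1 \<le> n" unfolding n_def by (rule one_le_power) simp
  then have M: "M \<ge> 1" unfolding M_def by (intro one_le_power) simp
  have e: "2 ^ rate d \<kappa> = M * real n ^ 2"
    unfolding M_def n_def rate_def of_nat_power of_nat_numeral power_mult[symmetric] power_add[symmetric]
    by (simp add: algebra_simps)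
  have n2: "real n ^ 2 = 16 * 2 ^ \<kappa> * 2 ^ \<kappa>"
    by (simp add: n_def power_add power2_eq_square)
  have n2': "real n ^ 2 \<ge> 4 * 2 ^ \<kappa>"
  proof -
    have "(1::real) \<le> 2 ^ \<kappa>" by simp
    then have "1 \<le> 4 * (2::real) ^ \<kappa>" by linarith
    then have "4 * 2 ^ \<kappa> * (1::real) \<le> 4 * 2 ^ \<kappa> * (4 * 2 ^ \<kappa>)"
      by (rule mult_left_mono) simp
    then show ?thesis by (simp add: n2)
  qed
  have "(1 + real (n ^ (2 * d))) * (2 * (1 / 2 ^ rate d \<kappa>)) = (1 + M) * 2 / (M * real n ^ 2)"
    by (simp add: e M_def)
  also have "\<dots> \<le> (2 * M) * 2 / (M * real n ^ 2)"
    using M by (intro divide_right_mono mult_right_mono) auto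
  also have "\<dots> = 4 / real n ^ 2" using M by (simp add: field_simps)
  also have "\<dots> \<le> 4 / (4 * 2 ^ \<kappa>)" using n2' by (intro divide_left_mono) (auto simp: n_def)
  finally show ?thesis by simp
qed

context
  fixes p :: "(real ^ 'd::finite) measure"
  assumes p: "prob_space p" and sets_p: "sets p = sets borel"
begin

lemma collision_sets:
  assumes [measurable]: "f \<in> borel_measurable M" "g \<in> borel_measurable M"
  shows "{\<omega> \<in> space M. f \<omega> \<noteq> g \<omega> \<and> cell p N k (f \<omega>) = cell p N k (g \<omega>)} \<in> sets M"
proof -
  have [measurable]: "(\<lambda>\<omega>. real (cell p N k (h \<omega>))) \<in> borel_measurable M" if "h \<in> borel_measurable M" for h
    using measurable_compose[OF measurable_compose[OF that cell_measurable[OF p sets_p]], of real borel] by simp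
  have "{\<omega> \<in> space M. f \<omega> \<noteq> g \<omega> \<and> real (cell p N k (f \<omega>)) = real (cell p N k (g \<omega>))} \<in> sets M"
    by measurable
  then show ?thesis by simp
qed

lemma point_feature_measurable:
  assumes "f \<in> borel_measurable M"
  shows "(\<lambda>\<omega>. point_feature p \<kappa> (f \<omega>) g) \<in> borel_measurable M"
  unfolding point_feature_def box_feature_def
proof (rule borel_measurable_prod)
  fix k
  have "(\<lambda>\<omega>. f \<omega> $ k) \<in> borel_measurable M"
    by (rule measurable_compose[OF assms]) measurable
  then have "(\<lambda>\<omega>. cell p (2 ^ \<kappa>) k (f \<omega> $ k)) \<in> M \<rightarrow>\<^sub>M count_space UNIV"
    by (rule measurable_compose[OF _ cell_measurable[OF p sets_p]])
  then show "(\<lambda>\<omega>. dyadic (cell p (2 ^ \<kappa>) k (f \<omega> $ k)) (g k)) \<in> borel_measurable M"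
    by (rule measurable_compose) simp
qed

lemma level_walk_measurable:
  assumes "\<And>j. s < j \<Longrightarrow> j \<le> i \<Longrightarrow> (\<lambda>\<omega>. x \<omega> j) \<in> borel_measurable M"
    and "\<And>j. s < j \<Longrightarrow> j \<le> i \<Longrightarrow> (\<lambda>\<omega>. r \<omega> j) \<in> borel_measurable M" and "s < i"
  shows "(\<lambda>\<omega>. level_walk p \<kappa> (x \<omega>) (r \<omega>) s i) \<in> borel_measurable M"
  unfolding level_walk_def
proof (rule walk_measurable)
  fix j l assume "s < j" "j < l" "l \<le> i"
  then show "(\<lambda>\<omega>. gram (box_index (Suc \<kappa>)) (\<lambda>j. point_feature p \<kappa> (x \<omega> j)) j l) \<in> borel_measurable M"
    unfolding gram_def by (intro borel_measurable_sum borel_measurable_times point_feature_measurable assms) auto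
qed (use assms in auto)

lemma level_exceeds_measurable:
  assumes "\<And>j. j \<in> {1..n} \<Longrightarrow> (\<lambda>\<omega>. x \<omega> j) \<in> borel_measurable M"
    and "\<And>j. j \<in> {1..n} \<Longrightarrow> (\<lambda>\<omega>. r \<omega> j) \<in> borel_measurable M"
  shows "Measurable.pred M (\<lambda>\<omega>. exceeds {s<..n} (level_walk p \<kappa> (x \<omega>) (r \<omega>) s) (x \<omega>) h)"
  by (intro exceeds_measurable level_walk_measurable assms) auto

text \<open>Without collisions every box acts on the points as a grid box, and its signed count is
  the walk tested against \<open>box_coeff\<close>. This leaves a finite set of directions for
  \<open>walk_failure\<close>.\<close>

lemma level_walk_failure:
  assumes "\<not> collision p (2 ^ \<kappa>) {s<..t} x"
  shows "emeasure seed_space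
      {r. \<exists>n\<in>{s<..t}. exceeds {s<..n} (level_walk p \<kappa> x r s) x (threshold CARD('d) \<kappa>)}
    \<le> ennreal (real t / 2 ^ \<kappa>)"
proof -
  define d where "d = CARD('d)"
  define R where "R = real (\<kappa> + 2) ^ d"
  define R' where "R' = (4 * real (\<kappa> + 2)) ^ d"
  define c where "c = clip d \<kappa>"
  define h where "h = threshold d \<kappa>"
  define E where "E = rate d \<kappa>"
  define n where "n = (2::nat) ^ (\<kappa> + 2)"
  define U where "U = (grid_boxes n :: (('d \<Rightarrow> nat) \<times> ('d \<Rightarrow> nat)) set)"
  define I where "I = (box_index (Suc \<kappa>) :: ('d \<Rightarrow> nat \<times> nat) set)"
  define v where "v j = point_feature p \<kappa> (x j)" for j
  define W where "W r = walk (gram I v) c r s" for r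
  have E1: "real E \<ge> 1" by (simp add: E_def rate_def)
  have R: "R > 0" by (simp add: R_def)
  have R': "R' = 4 ^ d * R" unfolding R'_def R_def power_mult_distrib ..
  have c: "c = 2 * R * E" by (simp add: c_def clip_def R_def E_def)
  have h: "h = 2 * 2 ^ d * R * E" by (simp add: h_def threshold_def R_def E_def)
  have four: "(4::real) ^ d = 2 ^ d * 2 ^ d" by (simp flip: power_mult_distrib)
  have cell: "cell p (2 ^ \<kappa>) k y \<le> 2 ^ Suc \<kappa>" for k y
    using cell_le[OF p sets_p, of "2 ^ \<kappa>" k y] by simp
  have cell': "cell p (2 ^ \<kappa>) k y \<le> 2 ^ Suc (Suc \<kappa>)" for k y
    using cell[of k y] by simp
  have celln: "Suc (cell p (2 ^ \<kappa>) k y) < n" for k y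
  proof -
    have "n = 4 * 2 ^ \<kappa>" "0 < (2::nat) ^ \<kappa>" by (simp_all add: n_def)
    then show ?thesis using cell[of k y] unfolding power_Suc by linarith
  qed
  have sub: "{r. \<exists>m\<in>{s<..t}. exceeds {s<..m} (level_walk p \<kappa> x r s) x h}
      \<subseteq> {r. \<exists>m\<in>{s<..t}. \<exists>ab\<in>U. h < \<bar>\<Sum>j\<in>{s<..m}. W r j * (\<Sum>g\<in>I. v j g * box_coeff ab g)\<bar>}"
  proof safe
    fix r m assume m: "m \<in> {s<..t}" and ex: "exceeds {s<..m} (level_walk p \<kappa> x r s) x h"
    then obtain B where B: "axis_parallel_box B" "h < \<bar>\<Sum>j\<in>{s<..m}. W r j * indicator B (x j)\<bar>"
      unfolding exceeds_def level_walk_def W_def I_def v_def c_def d_def by blast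
    have inj: "x i $ k = x j $ k"
      if "i \<in> {s<..m}" "j \<in> {s<..m}" "cell p (2 ^ \<kappa>) k (x i $ k) = cell p (2 ^ \<kappa>) k (x j $ k)" for i j k
      using assms that m unfolding collision_def by (metis greaterThanAtMost_iff le_trans)
    obtain a b where ab: "(a, b) \<in> grid_boxes n" "\<And>k. a k \<le> b k"
      "\<And>j. j \<in> {s<..m} \<Longrightarrow> x j \<in> B \<longleftrightarrow> (\<forall>k. a k \<le> cell p (2 ^ \<kappa>) k (x j $ k) \<and> cell p (2 ^ \<kappa>) k (x j $ k) < b k)"
      by (rule box_eq_grid_box[where f = "cell p (2 ^ \<kappa>)" and T = "{s<..m}" and x = x and n = n and B = B])
         (use cell_mono[OF p sets_p] celln inj B(1) in blast)+
    have b: "b k < 2 ^ Suc (Suc \<kappa>)" for k using ab(1) by (auto simp: grid_boxes_def n_def)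
    have "(\<Sum>j\<in>{s<..m}. W r j * indicator B (x j)) = (\<Sum>j\<in>{s<..m}. W r j * (\<Sum>g\<in>I. v j g * box_coeff (a, b) g))"
    proof (intro sum.cong refl arg_cong2[where f = "(*)"])
      fix j assume j: "j \<in> {s<..m}"
      show "indicator B (x j) = (\<Sum>g\<in>I. v j g * box_coeff (a, b) g)"
        unfolding I_def v_def point_feature_def box_decomposition[OF cell' b ab(2)]
        using ab(3)[OF j] by (simp add: indicator_def)
    qed
    with B(2) ab(1) m show "\<exists>m\<in>{s<..t}. \<exists>ab\<in>U. h < \<bar>\<Sum>j\<in>{s<..m}. W r j * (\<Sum>g\<in>I. v j g * box_coeff ab g)\<bar>"
      unfolding U_def by (intro bexI[of _ m] bexI[of _ "(a, b)"]) auto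
  qed
  have fail: "emeasure seed_space {r. \<exists>m\<in>{s<..t}. \<exists>ab\<in>U. h < \<bar>\<Sum>j\<in>{s<..m}. W r j * (\<Sum>g\<in>I. v j g * box_coeff ab g)\<bar>}
      \<le> ennreal (real t * ((1 + card U) * (2 * (1 / 2 ^ E))))"
    unfolding W_def
  proof (rule walk_failure)
    have pw: "exp (- real E) \<le> 1 / 2 ^ E"
    proof -
      have "(2::real) \<le> exp 1" using exp_ge_add_one_self[of 1] by simp
      then have "2 ^ E \<le> exp (1::real) ^ E" by (intro power_mono) auto
      also have "\<dots> = exp (real E)" by (simp flip: exp_of_nat_mult)
      finally show ?thesis by (simp add: exp_minus field_simps)
    qed
    show "(\<Sum>g\<in>I. (v i g)\<^sup>2) \<le> R" for i
      unfolding I_def v_def point_feature_def box_feature_norm[OF cell'] R_def d_def by simp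
    show "0 < R" by fact
    show "R \<le> c" unfolding c using R E1 by (simp add: mult_le_cancel_left1)
    show "finite U" unfolding U_def by (rule finite_grid_boxes)
    show "(\<Sum>g\<in>I. (box_coeff ab g)\<^sup>2) \<le> R'" for ab
      using box_coeff_norm[where L = "Suc \<kappa>" and ab = ab] by (simp add: I_def R'_def d_def)
    show "0 < R'" using R by (simp add: R')
    show "0 \<le> h" by (simp add: h_def threshold_nonneg)
    have "c / (2 * R) = E" using R by (simp add: c)
    then show "exp (- (c / (2 * R))) \<le> 1 / 2 ^ E" using pw by simp
    have "h\<^sup>2 / (2 * c * R') = E"
      using R E1 by (simp add: c h R' four power2_eq_square field_simps)
    then show "exp (- (h\<^sup>2 / (2 * c * R'))) \<le> 1 / 2 ^ E" using pw by simp
  qed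
  have "emeasure seed_space {r. \<exists>m\<in>{s<..t}. exceeds {s<..m} (level_walk p \<kappa> x r s) x h}
      \<le> emeasure seed_space {r. \<exists>m\<in>{s<..t}. \<exists>ab\<in>U. h < \<bar>\<Sum>j\<in>{s<..m}. W r j * (\<Sum>g\<in>I. v j g * box_coeff ab g)\<bar>}"
  proof (intro emeasure_mono sub sets_seed_Collect pred_intros_finite(4))
    fix m ab
    show "Measurable.pred seed_space (\<lambda>r. h < \<bar>\<Sum>j\<in>{s<..m}. W r j * (\<Sum>g\<in>I. v j g * box_coeff ab g)\<bar>)"
      unfolding W_def by measurable
  qed (auto simp: U_def finite_grid_boxes)
  also note fail
  also have "real t * ((1 + card U) * (2 * (1 / 2 ^ E))) \<le> real t * (1 / 2 ^ \<kappa>)"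
    using failure_arith[of \<kappa> d] unfolding U_def card_grid_boxes n_def E_def d_def
    by (intro mult_left_mono) auto
  finally show ?thesis by (simp add: h_def d_def ennreal_leI)
qed

section \<open>Failure probability over random points and seeds\<close>

text \<open>Union bound over pairs of times and coordinates. For distinct times one point is
  resampled with the other fixed, which reduces to \<open>cell_collision\<close>; a point never
  collides with itself.\<close>

lemma product_collision:
  assumes N: "N > 0"
  shows "{x \<in> space (\<Pi>\<^sub>M i\<in>{1..t}. p). collision p N {1..t} x} \<in> sets (\<Pi>\<^sub>M i\<in>{1..t}. p)" (is "?C \<in> sets ?P")
    and "emeasure (\<Pi>\<^sub>M i\<in>{1..t}. p) {x \<in> space (\<Pi>\<^sub>M i\<in>{1..t}. p). collision p N {1..t} x}
      \<le> ennreal (real t * real t * CARD('d) / N)"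
proof -
  define D where "D i j k = {x \<in> space ?P. x j $ k \<noteq> x i $ k \<and> cell p N k (x j $ k) = cell p N k (x i $ k)}"
    for i j :: nat and k :: 'd
  have cm: "(\<lambda>x. x i $ k) \<in> borel_measurable ?P" if "i \<in> {1..t}" for i k
  proof -
    have "(\<lambda>x. x i) \<in> ?P \<rightarrow>\<^sub>M p" using that by (rule measurable_component_singleton)
    then have "(\<lambda>x. x i) \<in> borel_measurable ?P" using measurable_cong_sets[OF refl sets_p] by blast
    then show ?thesis by (rule measurable_compose) measurable
  qed
  have D: "D i j k \<in> sets ?P" if "i \<in> {1..t}" "j \<in> {1..t}" for i j k
    unfolding D_def by (rule collision_sets) (use cm that in auto)
  have C: "?C = (\<Union>i\<in>{1..t}. \<Union>j\<in>{1..t}. \<Union>k\<in>UNIV. D i j k)"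
    by (auto simp: collision_def D_def)
  show "?C \<in> sets ?P"
    unfolding C by (intro sets.finite_UN D) auto
  have DP: "emeasure ?P (D i j k) \<le> ennreal (1 / N)" if ij: "i \<in> {1..t}" "j \<in> {1..t}" for i j k
  proof (cases "i = j")
    case False
    interpret P: prob_space ?P by (rule prob_space_PiM) (rule p)
    have "emeasure ?P (D i j k) = (\<integral>\<^sup>+x. indicator (D i j k) x \<partial>?P)"
      using D[OF ij] by simp
    also have "\<dots> = (\<integral>\<^sup>+x. (\<integral>\<^sup>+y. indicator (D i j k) (x(j := y)) \<partial>p) \<partial>?P)"
      by (rule nn_integral_PiM_resample) (use p ij D[OF ij] in auto)
    also have "\<dots> \<le> (\<integral>\<^sup>+x. ennreal (1 / N) \<partial>?P)"
    proof (rule nn_integral_mono)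
      fix x
      define Z where "Z = {y. y $ k \<noteq> x i $ k \<and> cell p N k (y $ k) = cell p N k (x i $ k)}"
      have Zs: "Z \<in> sets p"
      proof -
        have "{y \<in> space borel. y $ k \<noteq> x i $ k \<and> cell p N k (y $ k) = cell p N k (x i $ k)} \<in> sets borel"
          by (rule collision_sets) measurable
        then show ?thesis by (simp add: Z_def sets_p)
      qed
      have "(\<integral>\<^sup>+y. indicator (D i j k) (x(j := y)) \<partial>p) \<le> (\<integral>\<^sup>+y. indicator Z y \<partial>p)"
        using False by (intro nn_integral_mono) (auto simp: indicator_def D_def Z_def)
      also have "\<dots> = emeasure p Z" using Zs by simp
      also have "\<dots> \<le> ennreal (1 / N)"
        using cell_collision[OF p sets_p N, of k "x i $ k"] p
        by (simp add: Z_def finite_measure.emeasure_eq_measure prob_space.finite_measure ennreal_leI)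
      finally show "(\<integral>\<^sup>+y. indicator (D i j k) (x(j := y)) \<partial>p) \<le> ennreal (1 / N)" .
    qed
    also have "\<dots> = ennreal (1 / N)" by (simp only: nn_integral_const P.emeasure_space_1 mult_1_right)
    finally show ?thesis .
  qed (simp add: D_def)
  have "emeasure ?P ?C \<le> (\<Sum>i\<in>{1..t}. emeasure ?P (\<Union>j\<in>{1..t}. \<Union>k\<in>UNIV. D i j k))"
    unfolding C by (intro emeasure_subadditive_finite) (auto intro!: sets.finite_UN D simp del: One_nat_def)
  also have "\<dots> \<le> (\<Sum>i\<in>{1..t}. \<Sum>j\<in>{1..t}. emeasure ?P (\<Union>k\<in>UNIV. D i j k))"
    by (intro sum_mono emeasure_subadditive_finite) (auto intro!: sets.finite_UN D simp del: One_nat_def)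
  also have "\<dots> \<le> (\<Sum>i\<in>{1..t}. \<Sum>j\<in>{1..t}. \<Sum>k\<in>UNIV. emeasure ?P (D i j k))"
    by (intro sum_mono emeasure_subadditive_finite) (auto intro!: D simp del: One_nat_def)
  also have "\<dots> \<le> (\<Sum>i\<in>{1..t}. \<Sum>j\<in>{1..t}. \<Sum>k\<in>(UNIV::'d set). ennreal (1 / N))"
    by (intro sum_mono DP)
  also have "\<dots> = ennreal (\<Sum>i\<in>{1..t}. \<Sum>j\<in>{1..t}. \<Sum>k\<in>(UNIV::'d set). 1 / N)"
    by (simp only: sum_ennreal zero_le_divide_1_iff of_nat_0_le_iff sum_nonneg)
  also have "\<dots> = ennreal (real t * real t * CARD('d) / N)"
    by (simp add: field_simps)
  finally show "emeasure ?P ?C \<le> ennreal (real t * real t * CARD('d) / N)" .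
qed

definition level_failure :: "nat \<Rightarrow> nat \<Rightarrow> ((nat \<Rightarrow> real ^ 'd) \<times> (nat \<Rightarrow> real)) set" where
  "level_failure \<kappa> t = {\<omega> \<in> space (run_space p t). \<exists>s\<in>{..<t}. \<exists>n\<in>{s<..t}.
     exceeds {s<..n} (level_walk p \<kappa> (fst \<omega>) (snd \<omega>) s) (fst \<omega>) (threshold CARD('d) \<kappa>)}"

lemma prob_space_run: "prob_space (run_space p t)"
proof -
  have "prob_space (\<Pi>\<^sub>M i\<in>{1..t}. p)" by (rule prob_space_PiM) (rule p)
  then show ?thesis unfolding run_space_def by (rule prob_space_pair[OF _ prob_space_seed])
qed

lemma run_point_measurable:
  assumes "j \<in> {1..t}"
  shows "(\<lambda>\<omega>. fst \<omega> j) \<in> borel_measurable (run_space p t)"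
proof -
  have "(\<lambda>x. x j) \<in> (\<Pi>\<^sub>M i\<in>{1..t}. p) \<rightarrow>\<^sub>M p" using assms by (rule measurable_component_singleton)
  then have "(\<lambda>x. x j) \<in> borel_measurable (\<Pi>\<^sub>M i\<in>{1..t}. p)" using measurable_cong_sets[OF refl sets_p] by blast
  then show ?thesis unfolding run_space_def by (rule measurable_compose[OF measurable_fst])
qed

lemma run_seed_measurable: "(\<lambda>\<omega>. snd \<omega> j) \<in> borel_measurable (run_space p t)"
  unfolding run_space_def by measurable

lemma level_failure_sets: "level_failure \<kappa> t \<in> sets (run_space p t)"
proof -
  have "Measurable.pred (run_space p t) (\<lambda>\<omega>. \<exists>s\<in>{..<t}. \<exists>n\<in>{s<..t}.
     exceeds {s<..n} (level_walk p \<kappa> (fst \<omega>) (snd \<omega>) s) (fst \<omega>) (threshold CARD('d) \<kappa>))"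
    by (intro pred_intros_finite(4) level_exceeds_measurable run_point_measurable run_seed_measurable) auto
  then show ?thesis unfolding level_failure_def by (rule predE)
qed

text \<open>Fubini with the points outside. Configurations with a collision are bounded by 1 and
  cost t^2 d / 2^\<kappa>; for the others the t starting times cost t / 2^\<kappa> each.\<close>

lemma level_failure_measure:
  "measure (run_space p t) (level_failure \<kappa> t) \<le> real t * real t * (1 + CARD('d)) / 2 ^ \<kappa>"
proof -
  let ?P = "\<Pi>\<^sub>M i\<in>{1..t}. p"
  interpret R: prob_space "run_space p t" by (rule prob_space_run)
  interpret P: prob_space ?P by (rule prob_space_PiM) (rule p)
  interpret S: prob_space seed_space by (rule prob_space_seed)
  define C where "C = {x \<in> space ?P. collision p (2 ^ \<kappa>) {1..t} x}"
  have C: "C \<in> sets ?P" "emeasure ?P C \<le> ennreal (real t * real t * CARD('d) / 2 ^ \<kappa>)"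
    using product_collision[of "2 ^ \<kappa>" t] by (simp_all add: C_def)
  define F where "F x s = {r. \<exists>n\<in>{s<..t}. exceeds {s<..n} (level_walk p \<kappa> x r s) x (threshold CARD('d) \<kappa>)}" for x s
  have Fs: "F x s \<in> sets seed_space" for x s
    unfolding F_def
    by (intro sets_seed_Collect pred_intros_finite(4) level_exceeds_measurable) auto
  have sect: "emeasure seed_space (Pair x -` level_failure \<kappa> t)
      \<le> indicator C x + ennreal (real t * (real t / 2 ^ \<kappa>))" if x: "x \<in> space ?P" for x
  proof (cases "x \<in> C")
    case True
    have "emeasure seed_space (Pair x -` level_failure \<kappa> t) \<le> 1 + 0"
      using S.emeasure_le_1 by simp
    also have "\<dots> \<le> indicator C x + ennreal (real t * (real t / 2 ^ \<kappa>))"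
      using True by (intro add_mono) auto
    finally show ?thesis .
  next
    case False
    have nc: "\<not> collision p (2 ^ \<kappa>) {s<..t} x" for s
    proof
      assume "collision p (2 ^ \<kappa>) {s<..t} x"
      then have "collision p (2 ^ \<kappa>) {1..t} x"
        by (rule collision_mono[rotated]) auto
      then show False using False x by (simp add: C_def)
    qed
    have "emeasure seed_space (Pair x -` level_failure \<kappa> t) \<le> emeasure seed_space (\<Union>s\<in>{..<t}. F x s)"
      by (intro emeasure_mono sets.finite_UN Fs) (auto simp: level_failure_def F_def)
    also have "\<dots> \<le> (\<Sum>s\<in>{..<t}. emeasure seed_space (F x s))"
      by (intro emeasure_subadditive_finite) (auto intro: Fs)
    also have "\<dots> \<le> (\<Sum>s\<in>{..<t}. ennreal (real t / 2 ^ \<kappa>))"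
      unfolding F_def by (intro sum_mono level_walk_failure nc)
    also have "\<dots> = ennreal (\<Sum>s\<in>{..<t}. real t / 2 ^ \<kappa>)"
      by (subst sum_ennreal) auto
    also have "\<dots> = ennreal (real t * (real t / 2 ^ \<kappa>))" by simp
    finally show ?thesis using False by simp
  qed
  have "emeasure (run_space p t) (level_failure \<kappa> t)
      = (\<integral>\<^sup>+x. emeasure seed_space (Pair x -` level_failure \<kappa> t) \<partial>?P)"
    using level_failure_sets[of \<kappa> t] unfolding run_space_def by (rule S.emeasure_pair_measure_alt)
  also have "\<dots> \<le> (\<integral>\<^sup>+x. indicator C x + ennreal (real t * (real t / 2 ^ \<kappa>)) \<partial>?P)"
    by (intro nn_integral_mono sect)
  also have "\<dots> = emeasure ?P C + ennreal (real t * (real t / 2 ^ \<kappa>))"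
    using C(1) by (subst nn_integral_add)
      (simp_all only: nn_integral_const nn_integral_indicator P.emeasure_space_1 mult_1_right
        borel_measurable_indicator borel_measurable_const)
  also have "\<dots> \<le> ennreal (real t * real t * CARD('d) / 2 ^ \<kappa>) + ennreal (real t * (real t / 2 ^ \<kappa>))"
    by (intro add_mono C) auto
  also have "\<dots> = ennreal (real t * real t * (1 + CARD('d)) / 2 ^ \<kappa>)"
    by (simp add: add_divide_distrib algebra_simps flip: ennreal_plus)
  finally show ?thesis by (simp add: R.emeasure_eq_measure)
qed

end

subsection \<open>Restarts\<close>

text \<open>The state (k, s) after \<open>i\<close> points: the walk now running has \<kappa> = 2^k
  and started after time \<open>s\<close>. The point that triggers a restart still belongs to the
  old phase.\<close>

primrec phase :: "(real ^ 'd::finite) measure \<Rightarrow> (nat \<Rightarrow> real ^ 'd) \<Rightarrow> (nat \<Rightarrow> real) \<Rightarrow> nat \<Rightarrow> nat \<times> nat" where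
  "phase p x r 0 = (0, 0)"
| "phase p x r (Suc i) = (case phase p x r i of (k, s) \<Rightarrow>
     if exceeds {s<..Suc i} (level_walk p (2 ^ k) x r s) x (threshold CARD('d) (2 ^ k))
     then (Suc k, Suc i) else (k, s))"

definition balancing_sign ::
  "(real ^ 'd::finite) measure \<Rightarrow> (nat \<Rightarrow> real ^ 'd) \<Rightarrow> (nat \<Rightarrow> real) \<Rightarrow> nat \<Rightarrow> real" where
  "balancing_sign p x r i = (case phase p x r (i - 1) of (k, s) \<Rightarrow> level_walk p (2 ^ k) x r s i)"

text \<open>The current time is the length of the list; the shift by one passes from list positions
  to times counted from 1.\<close>

definition balancing_alg :: "'d::finite online_alg" where
  "balancing_alg p r xs = balancing_sign p (\<lambda>j. xs ! (j - 1)) r (length xs)"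

lemma balancing_sign_cases: "balancing_sign p x r i \<in> {-1, 1}"
  unfolding balancing_sign_def split_beta by (rule level_walk_cases)

lemma phase_start_le: "snd (phase p x r i) \<le> i"
  by (induction i) (auto split: prod.splits)

lemma phase_cong:
  "(\<And>j. 1 \<le> j \<Longrightarrow> j \<le> i \<Longrightarrow> x j = x' j) \<Longrightarrow> phase p x r i = phase p x' r i"
proof (induction i)
  case (Suc i)
  then have IH: "phase p x r i = phase p x' r i" by simp
  obtain k s where ks: "phase p x' r i = (k, s)" by force
  have "exceeds {s<..Suc i} (level_walk p (2 ^ k) x r s) x h
      \<longleftrightarrow> exceeds {s<..Suc i} (level_walk p (2 ^ k) x' r s) x' h" for h
    by (intro exceeds_cong level_walk_cong Suc.prems) auto
  then show ?case by (simp add: IH ks)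
qed simp

text \<open>The state before step \<open>i\<close> and the sign at \<open>i\<close> look at the
  first \<open>i\<close> points only, so the list may be replaced by the whole sequence.\<close>

lemma chosen_sign_balancing:
  assumes "1 \<le> i"
  shows "chosen_sign balancing_alg p r x i = balancing_sign p x r i"
proof -
  let ?x = "\<lambda>j. map x [1..<Suc i] ! (j - 1)"
  have x: "?x j = x j" if "1 \<le> j" "j \<le> i" for j
    using that by (simp add: nth_append del: upt_Suc)
  have ph: "phase p ?x r (i - 1) = phase p x r (i - 1)" by (intro phase_cong x) auto
  obtain k s where ks: "phase p x r (i - 1) = (k, s)" by force
  have "s \<le> i - 1" using phase_start_le[of p x r "i - 1"] ks by simp
  then have "level_walk p (2 ^ k) ?x r s i = level_walk p (2 ^ k) x r s i"
    using assms by (intro level_walk_cong x) auto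
  then show ?thesis
    using ph ks by (simp add: chosen_sign_def balancing_alg_def balancing_sign_def del: upt_Suc)
qed

lemma phase_measurable:
  fixes p :: "(real ^ 'd::finite) measure"
  assumes p: "prob_space p" "sets p = sets borel"
    and x: "\<And>j. j \<in> {1..i} \<Longrightarrow> (\<lambda>\<omega>. x \<omega> j) \<in> borel_measurable M"
    and r: "\<And>j. j \<in> {1..i} \<Longrightarrow> (\<lambda>\<omega>. r \<omega> j) \<in> borel_measurable M"
  shows "(\<lambda>\<omega>. phase p (x \<omega>) (r \<omega>) i) \<in> M \<rightarrow>\<^sub>M count_space UNIV"
  using x r
proof (induction i)
  case (Suc i)
  have IH: "(\<lambda>\<omega>. phase p (x \<omega>) (r \<omega>) i) \<in> M \<rightarrow>\<^sub>M count_space UNIV"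
    by (rule Suc.IH) (use Suc.prems in auto)
  show ?case
    unfolding phase.simps
  \<comment> \<open>The state has countably many values, so it may be frozen at one of them.\<close>
  proof (rule measurable_compose_countable'[OF _ IH])
    fix ks :: "nat \<times> nat"
    obtain k s where ks: "ks = (k, s)" by force
    have [measurable]: "Measurable.pred M (\<lambda>\<omega>. exceeds {s<..Suc i} (level_walk p (2 ^ k) (x \<omega>) (r \<omega>) s) (x \<omega>)
        (threshold CARD('d) (2 ^ k)))"
      by (intro level_exceeds_measurable[OF p] Suc.prems)
    show "(\<lambda>\<omega>. case ks of (k, s) \<Rightarrow>
        if exceeds {s<..Suc i} (level_walk p (2 ^ k) (x \<omega>) (r \<omega>) s) (x \<omega>) (threshold CARD('d) (2 ^ k))
        then (Suc k, Suc i) else (k, s)) \<in> M \<rightarrow>\<^sub>M count_space UNIV"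
      unfolding ks split by measurable
  qed auto
qed simp

lemma balancing_sign_measurable:
  fixes p :: "(real ^ 'd::finite) measure"
  assumes p: "prob_space p" "sets p = sets borel"
    and x: "\<And>j. j \<in> {1..i} \<Longrightarrow> (\<lambda>\<omega>. x \<omega> j) \<in> borel_measurable M"
    and r: "\<And>j. j \<in> {1..i} \<Longrightarrow> (\<lambda>\<omega>. r \<omega> j) \<in> borel_measurable M" and i: "1 \<le> i"
  shows "(\<lambda>\<omega>. balancing_sign p (x \<omega>) (r \<omega>) i) \<in> borel_measurable M"
proof -
  \<comment> \<open>Recording that the restart time is at most \<open>i - 1\<close> in the codomain
    ensures s < i for each frozen state, as \<open>level_walk_measurable\<close> requires.\<close>
  have ph: "(\<lambda>\<omega>. phase p (x \<omega>) (r \<omega>) (i - 1)) \<in> M \<rightarrow>\<^sub>M count_space {ks. snd ks \<le> i - 1}"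
    by (rule measurable_count_space_extend[OF subset_UNIV])
       (use phase_start_le in \<open>auto intro!: phase_measurable[OF p] x r\<close>)
  show ?thesis
    unfolding balancing_sign_def
  proof (rule measurable_compose_countable'[OF _ ph])
    fix ks :: "nat \<times> nat" assume "ks \<in> {ks. snd ks \<le> i - 1}"
    then obtain k s where ks: "ks = (k, s)" "s < i" using i by (cases ks) auto
    show "(\<lambda>\<omega>. case ks of (k, s) \<Rightarrow> level_walk p (2 ^ k) (x \<omega>) (r \<omega>) s i) \<in> borel_measurable M"
      unfolding ks split by (intro level_walk_measurable[OF p] x r ks(2)) auto
  qed auto
qed

section \<open>Discrepancy accumulated over the phases\<close>

text \<open>A finished phase respected its threshold until its last point, which adds at most
  1.\<close>

definition phase_budget :: "nat \<Rightarrow> nat \<Rightarrow> real" where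
  "phase_budget d k = (\<Sum>l<k. threshold d (2 ^ l) + 1)"

lemma phase_budget_mono: "k \<le> k' \<Longrightarrow> phase_budget d k \<le> phase_budget d k'"
  unfolding phase_budget_def
  by (intro sum_mono2) (auto intro: add_nonneg_nonneg threshold_nonneg)

text \<open>The last two claims say that the signs since the restart are those of one walk within
  its threshold. At the next restart this charges the phase to the budget of the first
  claim.\<close>

lemma phase_invariant:
  fixes p :: "(real ^ 'd::finite) measure"
  assumes ph: "phase p x r i = (k, s)" and B: "axis_parallel_box B" "B \<subseteq> cbox 0 1"
  shows "\<bar>\<Sum>j=1..s. balancing_sign p x r j * indicator B (x j)\<bar> \<le> phase_budget CARD('d) k
    \<and> \<not> exceeds {s<..i} (level_walk p (2 ^ k) x r s) x (threshold CARD('d) (2 ^ k))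
    \<and> (\<forall>j\<in>{s<..i}. balancing_sign p x r j = level_walk p (2 ^ k) x r s j)"
  using ph
proof (induction i arbitrary: k s)
  case 0
  then show ?case using threshold_nonneg[of "CARD('d)" 1]
    by (auto simp: phase_budget_def exceeds_def)
next
  case (Suc i)
  obtain k' s' where ks': "phase p x r i = (k', s')" by force
  note IH = Suc.IH[OF ks']
  have s': "s' \<le> i" using phase_start_le[of p x r i] ks' by simp
  have sign: "balancing_sign p x r (Suc i) = level_walk p (2 ^ k') x r s' (Suc i)"
    by (simp add: balancing_sign_def ks')
  have agree: "\<forall>j\<in>{s'<..Suc i}. balancing_sign p x r j = level_walk p (2 ^ k') x r s' j"
    using IH sign by (auto simp: le_Suc_eq)
  show ?case
  proof (cases "exceeds {s'<..Suc i} (level_walk p (2 ^ k') x r s') x (threshold CARD('d) (2 ^ k'))")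
    case False
    then have "k = k'" "s = s'" using Suc.prems ks' by auto
    then show ?thesis using IH agree False by blast
  next
    case True
    then have ks: "k = Suc k'" "s = Suc i" using Suc.prems ks' by auto
    let ?f = "\<lambda>j. balancing_sign p x r j * indicator B (x j) :: real"
    \<comment> \<open>The sum up to the restart splits into earlier phases, the phase just ended
      without its last point, and that point.\<close>
    have "{1..i} = {1..s'} \<union> {s'<..i}" using s' by auto
    then have "(\<Sum>j=1..i. ?f j) = (\<Sum>j=1..s'. ?f j) + (\<Sum>j\<in>{s'<..i}. ?f j)"
      by (simp only:) (rule sum.union_disjoint; auto)
    moreover have "(\<Sum>j=1..Suc i. ?f j) = (\<Sum>j=1..i. ?f j) + ?f (Suc i)" by simp
    moreover have "\<bar>\<Sum>j\<in>{s'<..i}. ?f j\<bar> \<le> threshold CARD('d) (2 ^ k')"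
    proof -
      have "(\<Sum>j\<in>{s'<..i}. ?f j) = (\<Sum>j\<in>{s'<..i}. level_walk p (2 ^ k') x r s' j * indicator B (x j))"
        using IH by (intro sum.cong) auto
      then show ?thesis using IH B by (auto simp: exceeds_def not_less)
    qed
    moreover have "\<bar>?f (Suc i)\<bar> \<le> 1"
      using balancing_sign_cases[of p x r "Suc i"] by (auto simp: indicator_def)
    ultimately have "\<bar>\<Sum>j=1..Suc i. ?f j\<bar> \<le> phase_budget CARD('d) k"
      using IH unfolding ks phase_budget_def sum.lessThan_Suc by linarith
    then show ?thesis using threshold_nonneg[of "CARD('d)" "2 ^ k"] by (auto simp: ks exceeds_def)
  qed
qed

text \<open>The running phase adds at most one more threshold, hence \<open>Suc\<close>.\<close>

lemma disc_le_phase_budget: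
  fixes p :: "(real ^ 'd::finite) measure"
  assumes "axis_parallel_box B" "B \<subseteq> cbox 0 1"
  shows "\<bar>\<Sum>j=1..i. balancing_sign p x r j * indicator B (x j)\<bar>
    \<le> phase_budget CARD('d) (Suc (fst (phase p x r i)))"
proof -
  obtain k s where ks: "phase p x r i = (k, s)" by force
  note inv = phase_invariant[OF ks assms]
  have s: "s \<le> i" using phase_start_le[of p x r i] ks by simp
  let ?f = "\<lambda>j. balancing_sign p x r j * indicator B (x j) :: real"
  have "{1..i} = {1..s} \<union> {s<..i}" using s by auto
  then have "(\<Sum>j=1..i. ?f j) = (\<Sum>j=1..s. ?f j) + (\<Sum>j\<in>{s<..i}. ?f j)"
    by (simp only:) (rule sum.union_disjoint; auto)
  moreover have "\<bar>\<Sum>j\<in>{s<..i}. ?f j\<bar> \<le> threshold CARD('d) (2 ^ k)"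
  proof -
    have "(\<Sum>j\<in>{s<..i}. ?f j) = (\<Sum>j\<in>{s<..i}. level_walk p (2 ^ k) x r s j * indicator B (x j))"
      using inv by (intro sum.cong) auto
    then show ?thesis using inv assms by (auto simp: exceeds_def not_less)
  qed
  ultimately show ?thesis
    using inv unfolding ks fst_conv phase_budget_def sum.lessThan_Suc by linarith
qed

text \<open>The restart that left phase \<open>K\<close> is itself the witness. Its random starting
  time is hidden in an existential over all s < i, which is how the event
  \<open>level_failure\<close> is phrased.\<close>

lemma phase_passed_exceeds:
  fixes p :: "(real ^ 'd::finite) measure"
  shows "K < fst (phase p x r i) \<Longrightarrow>
    \<exists>s\<in>{..<i}. \<exists>n\<in>{s<..i}. exceeds {s<..n} (level_walk p (2 ^ K) x r s) x (threshold CARD('d) (2 ^ K))"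
proof (induction i)
  case (Suc i)
  obtain k s where ks: "phase p x r i = (k, s)" by force
  show ?case
  proof (cases "K < k")
    case True
    then obtain s n where "s \<in> {..<i}" "n \<in> {s<..i}"
      "exceeds {s<..n} (level_walk p (2 ^ K) x r s) x (threshold CARD('d) (2 ^ K))"
      using Suc.IH ks by auto
    then show ?thesis by (intro bexI[of _ s] bexI[of _ n]) auto
  next
    case False
    then have "K = k" "exceeds {s<..Suc i} (level_walk p (2 ^ k) x r s) x (threshold CARD('d) (2 ^ k))"
      using Suc.prems ks by (auto split: if_splits)
    moreover have "s \<le> i" using phase_start_le[of p x r i] ks by simp
    ultimately show ?thesis by (intro bexI[of _ s] bexI[of _ "Suc i"]) auto
  qed
qed simp

text \<open>The bracket bounds the coefficient of a threshold plus 1, the power of 3 comes from 2^l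
  + 2 \<le> 3 * 2^l, and the final 2 from a geometric sum of ratio at least 2.\<close>

definition budget_const :: "nat \<Rightarrow> real" where
  "budget_const d = (2 ^ (d + 1) * (2 * real d + 2) + 1) * 3 ^ (d + 1) * 2"

lemma budget_const_pos: "0 < budget_const d"
  unfolding budget_const_def by (intro mult_pos_pos add_nonneg_pos) auto

lemma phase_budget_le: "phase_budget d (Suc K) \<le> budget_const d * (2 ^ K) ^ (d + 1)"
proof -
  define D where "D = 2 ^ (d + 1) * (2 * real d + 2) + 1"
  define z :: real where "z = 2 ^ (d + 1)"
  have z: "z \<ge> 2" by (simp add: z_def)
  have D: "D \<ge> 0" by (simp add: D_def)
  have term_le: "threshold d (2 ^ l) + 1 \<le> D * 3 ^ (d + 1) * z ^ l" for l
  proof -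
    have one: "1 \<le> real (2 ^ l + 2) ^ (d + 1)" by (intro one_le_power) simp
    have "threshold d (2 ^ l) + 1 \<le> D * real (2 ^ l + 2) ^ (d + 1)"
      using one by (simp add: threshold_def rate_def D_def algebra_simps)
    also have "\<dots> \<le> D * (3 * 2 ^ l) ^ (d + 1)"
      using D one_le_power[of "2::real" l] by (intro mult_left_mono power_mono) auto
    also have "\<dots> = D * 3 ^ (d + 1) * z ^ l"
      by (simp add: z_def power_mult_distrib mult.commute flip: power_mult)
    finally show ?thesis .
  qed
  have geo: "(\<Sum>l<Suc K. z ^ l) \<le> 2 * z ^ K"
  proof (induction K)
    case (Suc K)
    have "2 * z ^ K \<le> z ^ Suc K" using z by simp
    then show ?case using Suc by simp
  qed simp
  have "phase_budget d (Suc K) \<le> (\<Sum>l<Suc K. D * 3 ^ (d + 1) * z ^ l)"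
    unfolding phase_budget_def by (intro sum_mono term_le)
  also have "\<dots> \<le> D * 3 ^ (d + 1) * (2 * z ^ K)"
    unfolding sum_distrib_left[symmetric] using D by (intro mult_left_mono geo) auto
  also have "\<dots> = budget_const d * (2 ^ K) ^ (d + 1)"
    by (simp add: budget_const_def D_def z_def mult.commute flip: power_mult)
  finally show ?thesis .
qed

section \<open>Choice of the level and the final probability bound\<close>

text \<open>The least K with 2^K \<ge> 3 log_2 y overshoots by a factor of at most 2.\<close>

lemma level_exists:
  fixes y :: real
  assumes "2 \<le> y"
  obtains K :: nat where "y ^ 3 \<le> 2 ^ 2 ^ K" "2 ^ K \<le> 6 / ln 2 * ln y"
proof -
  define w where "w = 3 * log 2 y"
  have w: "w \<ge> 3" using assms by (simp add: w_def)
  define K where "K = (LEAST K. w \<le> 2 ^ K)"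
  have "\<exists>K. w \<le> 2 ^ K" using real_arch_pow[of 2 w] less_imp_le by auto
  then have K: "w \<le> 2 ^ K" unfolding K_def by (rule LeastI_ex)
  \<comment> \<open>This is where y \<ge> 2 enters: w \<ge> 3 exceeds 2^0, so the minimality of
    \<open>K\<close> can be used at \<open>K - 1\<close>.\<close>
  have "K \<noteq> 0" using K w by (intro notI) simp
  then obtain K' where K': "K = Suc K'" using not0_implies_Suc by blast
  then have "\<not> w \<le> 2 ^ K'" using not_less_Least[of K' "\<lambda>K. w \<le> 2 ^ K"] unfolding K_def by auto
  then have "2 ^ K \<le> 2 * w" by (simp add: K')
  also have "\<dots> = 6 / ln 2 * ln y" by (simp add: w_def log_def)
  finally have up: "2 ^ K \<le> 6 / ln 2 * ln y" .
  have "y ^ 3 = (2 powr log 2 y) powr 3" using assms by (simp add: powr_realpow)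
  also have "\<dots> = 2 powr w" by (simp add: powr_powr w_def mult.commute)
  also have "\<dots> \<le> 2 powr real (2 ^ K)" using K by (intro powr_mono) auto
  also have "\<dots> = 2 ^ 2 ^ K" by (rule powr_realpow) simp
  finally show ?thesis using up that by blast
qed

text \<open>With z = d t / \<delta>, the numerator is at most 2 d t^2 = 2 z t \<delta> \<le> 2 z^2
  \<delta>. The third factor of y^3 absorbs the 2, thanks to the truncation.\<close>

lemma union_bound_arith:
  fixes t d :: nat and \<delta> :: real
  assumes t: "t \<ge> 1" and d: "d \<ge> 1" and \<delta>: "0 < \<delta>" "\<delta> < 1"
    and y: "y = max 2 (real d * real t / \<delta>)" and M: "y ^ 3 \<le> M"
  shows "real t * real t * (1 + d) / M \<le> \<delta>"
proof -
  define z where "z = real d * real t / \<delta>"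
  have z: "z \<ge> 0" "z \<le> y" "2 \<le> y" using \<delta> by (auto simp: z_def y)
  have "real t * real t * (1 + d) \<le> real t * real t * (2 * d)"
    using d by (intro mult_left_mono) auto
  also have "\<dots> = 2 * z * (real t * \<delta>)" using \<delta> by (simp add: z_def field_simps)
  also have "\<dots> \<le> 2 * z * (z * \<delta>)"
  proof -
    have "real t * \<delta> \<le> real t * 1" using \<delta> by (intro mult_left_mono) auto
    also have "\<dots> \<le> real t * d" using d by (intro mult_left_mono) auto
    also have "\<dots> = z * \<delta>" using \<delta> by (simp add: z_def field_simps)
    finally show ?thesis using z by (intro mult_left_mono) auto
  qed
  also have "\<dots> = \<delta> * (2 * z * z)" by simp
  also have "\<dots> \<le> \<delta> * (y * y * y)"
    using z \<delta> by (intro mult_left_mono mult_mono) auto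
  also have "\<dots> \<le> \<delta> * M" using M \<delta> by (intro mult_left_mono) (auto simp: power3_eq_cube)
  finally have "real t * real t * (1 + d) \<le> \<delta> * M" .
  moreover have "0 < M" using M z(3) by (smt (verit) zero_less_power)
  ultimately show ?thesis by (simp add: divide_le_eq)
qed

lemma online_algorithm_balancing: "online_algorithm (balancing_alg :: 'd::finite online_alg)"
  unfolding online_algorithm_def
proof (intro conjI allI impI)
  fix p :: "(real ^ 'd) measure" and r xs
  show "balancing_alg p r xs \<in> {-1, 1}" unfolding balancing_alg_def by (rule balancing_sign_cases)
next
  fix p :: "(real ^ 'd) measure" and i :: nat
  assume "distribution_on_cube p" and i: "1 \<le> i"
  then have p: "prob_space p" "sets p = sets borel" by (auto simp: distribution_on_cube_def)
  have "(\<lambda>\<omega>. balancing_sign p (fst \<omega>) (snd \<omega>) i) \<in> borel_measurable (run_space p i)"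
    by (intro balancing_sign_measurable p run_point_measurable run_seed_measurable i)
  then show "(\<lambda>(x, r). chosen_sign balancing_alg p r x i) \<in> borel_measurable (run_space p i)"
    by (simp add: chosen_sign_balancing[OF i] split_beta)
qed

theorem theorem3p2:
  "\<exists>C>0. \<exists>A :: 'd::finite online_alg. online_algorithm A \<and>
     (\<forall>t\<ge>1. \<forall>\<delta>. 0 < \<delta> \<and> \<delta> < 1 \<longrightarrow>
       (\<forall>p. distribution_on_cube p \<longrightarrow>
         measure (run_space p t)
           {(x, r) \<in> space (run_space p t).
              \<forall>B. axis_parallel_box B \<and> B \<subseteq> cbox 0 1 \<longrightarrow>
                (\<forall>i\<in>{1..t}. disc (chosen_sign A p r x) x i B
                   \<le> C * trunc_ln (real CARD('d) * real t / \<delta>) ^ (CARD('d) + 1))}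
         \<ge> 1 - \<delta>))"
proof -
  define d where "d = CARD('d)"
  \<comment> \<open>The level 2^K will be at most 6 / ln 2 times the truncated logarithm, and the
    budget is at most \<open>budget_const d\<close> times its power d + 1.\<close>
  define C where "C = budget_const d * (6 / ln 2) ^ (d + 1)"
  have C: "C > 0" unfolding C_def by (intro mult_pos_pos zero_less_power budget_const_pos) simp
  have main: "1 - \<delta> \<le> measure (run_space p t)
           {(x, r) \<in> space (run_space p t).
              \<forall>B. axis_parallel_box B \<and> B \<subseteq> cbox 0 1 \<longrightarrow>
                (\<forall>i\<in>{1..t}. disc (chosen_sign balancing_alg p r x) x i B
                   \<le> C * trunc_ln (real CARD('d) * real t / \<delta>) ^ (CARD('d) + 1))}"
    (is "_ \<le> measure _ ?good")
    if t: "1 \<le> t" and \<delta>: "0 < \<delta>" "\<delta> < 1" and "distribution_on_cube p"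
    for t :: nat and \<delta> :: real and p :: "(real ^ 'd) measure"
  proof -
    have p: "prob_space p" "sets p = sets borel" using that by (auto simp: distribution_on_cube_def)
    interpret prob_space "run_space p t" by (rule prob_space_run[OF p])
    define y where "y = max 2 (real d * real t / \<delta>)"
    define h where "h = C * trunc_ln (real d * real t / \<delta>) ^ (d + 1)"
    obtain K :: nat where K: "y ^ 3 \<le> 2 ^ 2 ^ K" "2 ^ K \<le> 6 / ln 2 * ln y"
      using level_exists[of y] by (auto simp: y_def)
    have d1: "d \<ge> 1" by (simp add: d_def Suc_leI)
    have budget: "phase_budget d (Suc K) \<le> h"
    proof -
      have "phase_budget d (Suc K) \<le> budget_const d * (2 ^ K) ^ (d + 1)" by (rule phase_budget_le)
      also have "\<dots> \<le> budget_const d * (6 / ln 2 * ln y) ^ (d + 1)"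
        by (intro mult_left_mono power_mono K) (auto simp: budget_const_def)
      also have "\<dots> = h"
        unfolding h_def C_def trunc_ln_def y_def power_mult_distrib by (simp only: mult.assoc)
      finally show ?thesis .
    qed
    \<comment> \<open>Written through \<open>exceeds\<close>, the quantifier over boxes becomes
      finite and the event measurable.\<close>
    have good: "?good = {\<omega> \<in> space (run_space p t).
        \<forall>i\<in>{1..t}. \<not> exceeds {1..i} (balancing_sign p (fst \<omega>) (snd \<omega>)) (fst \<omega>) h}"
    proof -
      have "disc (chosen_sign balancing_alg p r x) x i B = \<bar>\<Sum>j=1..i. balancing_sign p x r j * indicator B (x j)\<bar>"
        for x r i B
        unfolding disc_def by (intro arg_cong[where f = abs] sum.cong) (auto simp: chosen_sign_balancing)
      then show ?thesis
        by (auto simp: exceeds_def h_def d_def not_less)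
    qed
    have good_sets: "?good \<in> events"
    proof -
      have "Measurable.pred (run_space p t)
          (\<lambda>\<omega>. \<forall>i\<in>{1..t}. \<not> exceeds {1..i} (balancing_sign p (fst \<omega>) (snd \<omega>)) (fst \<omega>) h)"
        by (intro pred_intros_finite(3) pred_intros_logic exceeds_measurable balancing_sign_measurable
            p run_point_measurable[OF p] run_seed_measurable[OF p]) auto
      then show ?thesis unfolding good by (rule predE)
    qed
    \<comment> \<open>Outside the failure event of level 2^K the algorithm never leaves phase
      \<open>K\<close>, so the budget of the phases up to \<open>K\<close> bounds every
      discrepancy.\<close>
    have sub: "space (run_space p t) - level_failure p (2 ^ K) t \<subseteq> ?good"
      unfolding good
    proof (intro subsetI CollectI conjI ballI)
      fix \<omega> i assume \<omega>: "\<omega> \<in> space (run_space p t) - level_failure p (2 ^ K) t" and i: "i \<in> {1..t}"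
      have le: "fst (phase p (fst \<omega>) (snd \<omega>) i) \<le> K"
      proof (rule ccontr)
        assume "\<not> ?thesis"
        then obtain s n where "s \<in> {..<i}" "n \<in> {s<..i}"
          "exceeds {s<..n} (level_walk p (2 ^ K) (fst \<omega>) (snd \<omega>) s) (fst \<omega>) (threshold CARD('d) (2 ^ K))"
          using phase_passed_exceeds[of K p "fst \<omega>" "snd \<omega>" i] by (auto simp: not_le)
        then have "\<exists>s\<in>{..<t}. \<exists>n\<in>{s<..t}.
          exceeds {s<..n} (level_walk p (2 ^ K) (fst \<omega>) (snd \<omega>) s) (fst \<omega>) (threshold CARD('d) (2 ^ K))"
          using i by (intro bexI[of _ s] bexI[of _ n]) auto
        then show False using \<omega> by (simp add: level_failure_def[OF p])
      qed
      show "\<not> exceeds {1..i} (balancing_sign p (fst \<omega>) (snd \<omega>)) (fst \<omega>) h"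
      proof
        assume "exceeds {1..i} (balancing_sign p (fst \<omega>) (snd \<omega>)) (fst \<omega>) h"
        then obtain B where B: "axis_parallel_box B" "B \<subseteq> cbox 0 1"
          "h < \<bar>\<Sum>j=1..i. balancing_sign p (fst \<omega>) (snd \<omega>) j * indicator B (fst \<omega> j)\<bar>"
          by (auto simp: exceeds_def)
        note B(3)
        also note disc_le_phase_budget[OF B(1,2)]
        also have "phase_budget CARD('d) (Suc (fst (phase p (fst \<omega>) (snd \<omega>) i))) \<le> phase_budget d (Suc K)"
          unfolding d_def by (rule phase_budget_mono) (use le in simp)
        also note budget
        finally show False by simp
      qed
    qed auto
    have "prob (level_failure p (2 ^ K) t) \<le> real t * real t * (1 + d) / 2 ^ 2 ^ K"
      unfolding d_def by (rule level_failure_measure[OF p])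
    also have "\<dots> \<le> \<delta>" by (rule union_bound_arith[OF t d1 \<delta> y_def K(1)])
    finally have "1 - \<delta> \<le> prob (space (run_space p t) - level_failure p (2 ^ K) t)"
      using prob_compl[OF level_failure_sets[OF p, of "2 ^ K" t]] by simp
    also have "\<dots> \<le> prob ?good" by (rule finite_measure_mono[OF sub good_sets])
    finally show ?thesis .
  qed
  show ?thesis
    by (intro exI[of _ C] exI[of _ balancing_alg] conjI C online_algorithm_balancing allI impI main) auto
qed

end
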